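(* Let $m_1,m_2\in\mathbb{N}$ and let $v(x,t)$ be an $m_1\times m_2$ complex matrix function on the quarter-plane $\Omega_\infty=\{(x,t):\ 0\le x<\infty,\ 0\le t<\infty\}$. Assume that $v$ is continuously differentiable on $\Omega_\infty$, that the second derivative $v_{xx}$ exists on $\Omega_\infty$, and that $v$ satisfies the focusing nonlinear Schrödinger equation $$2v_t+\mathrm{i}\,(v_{xx}+2vv^*v)=0\quad\text{on }\Omega_\infty .$$ Assume moreover that for some $M>0$ $$\sup_{(x,t)\in\Omega_\infty}\|v(x,t)\|\le M,\qquad \sup_{t\ge 0}\|v_x(0,t)\|<\infty,$$ and that for each $c>0$ $$\sup_{0\le x<\infty,\ 0\le t<c}\|v_x(x,t)\|<\infty .$$ Let $\varphi(0,z)$ $(\Im z>M)$ be the Weyl function of the skew-selfadjoint Dirac system $y_x(x,z)=\big(\mathrm{i}zj+jV(x,0)\big)y(x,z)$ on $[0,\infty)$, and let $R_{ik}(t,z)$ be the $m_i\times m_k$ blocks $(i,k=1,2)$ of the matrix function $R(t,z)$ (with $V$, $j$, the Weyl function and $R(t,z)$ defined in the context). Then there exist $M_1>M$ and $M_2>0$ such that for all $z$ in the domain $$\mathcal{D}=\{z\in\mathbb{C}:\ \Im(z)>M_1,\ \Re(z)>M_2\}$$ we have $$\varphi(0,z)=-\lim_{t\to\infty}R_{22}(t,z)^{-1}R_{21}(t,z).$$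
   Context: Notation: $m=m_1+m_2$, $I_k$ is the $k\times k$ identity matrix, $^*$ denotes conjugate transpose, subscripts $x,t$ on functions denote partial derivatives (one-sided on the boundary), and $$j=\begin{bmatrix} I_{m_1}&0\\0&-I_{m_2}\end{bmatrix},\qquad V(x,t)=\begin{bmatrix}0&v(x,t)\\ v(x,t)^*&0\end{bmatrix}.$$ Weyl function. Let $u(x,z)$ be the $m\times m$ fundamental solution of the system $y_x=(\mathrm{i}zj+jV(x,0))y$ on $[0,\infty)$ normalized by $u(0,z)=I_m$. The Weyl function $\varphi(0,z)$ of this system is the $m_2\times m_1$ matrix function of $z$, holomorphic in the half-plane $\{z:\Im z>M\}$, such that $$\int_0^\infty\begin{bmatrix}I_{m_1}&\varphi(0,z)^*\end{bmatrix}u(x,z)^*u(x,z)\begin{bmatrix}I_{m_1}\\ \varphi(0,z)\end{bmatrix}dx<\infty\quad\text{for all } z \text{ with } \Im z>M.$$ Since $\|v(x,0)\|\le M$ for all $x\ge0$, it is known that this function exists and is unique, and that it coincides with the so-called generalized Weyl function (GW-function) of the system. (The argument $0$ in $\varphi(0,z)$ refers to $t=0$.) The matrix function $R$. Put $$F(x,t,z)=\mathrm{i}\Big(z^2j-\mathrm{i}z\,jV(x,t)-\tfrac12\big(V_x(x,t)+jV(x,t)^2\big)\Big).$$ Then $R(t,z)$ is the $m\times m$ matrix function determined by $$\frac{\partial}{\partial t}R(t,z)=F(0,t,z)R(t,z)\quad(t\ge0),\qquad R(0,z)=I_m,$$ and it is partitioned as $R(t,z)=\{R_{ik}(t,z)\}_{i,k=1}^2$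 with $R_{ik}$ of size $m_i\times m_k$. *)

theory Defs
  imports "HOL-Analysis.Analysis"
begin

text \<open>An \<open>m\<^sub>1 \<times> m\<^sub>2\<close> complex matrix is an element of \<open>complex ^ 'm2 ^ 'm1\<close>, and block matrices of
  size \<open>m = m\<^sub>1 + m\<^sub>2\<close> are indexed by the sum type \<open>'m1 + 'm2\<close>.\<close>

definition cscale :: "complex \<Rightarrow> complex ^ 'n ^ 'm \<Rightarrow> complex ^ 'n ^ 'm" (infixr \<open>\<cdot>\<^sub>c\<close> 75)
  where "c \<cdot>\<^sub>c A = map_matrix (\<lambda>a. c * a) A"

definition ctranspose :: "complex ^ 'n ^ 'm \<Rightarrow> complex ^ 'm ^ 'n"
  where "ctranspose A = map_matrix cnj (transpose A)"

text \<open>The spectral norm. The type class norm on matrices is the Frobenius norm, which is larger.\<close>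

definition opnorm :: "complex ^ 'n ^ 'm \<Rightarrow> real"
  where "opnorm A = onorm ((*v) A)"

definition block_matrix ::
  "complex ^ 'm1 ^ 'm1 \<Rightarrow> complex ^ 'm2 ^ 'm1 \<Rightarrow> complex ^ 'm1 ^ 'm2 \<Rightarrow> complex ^ 'm2 ^ 'm2
    \<Rightarrow> complex ^ ('m1 + 'm2) ^ ('m1 + 'm2)"
  where "block_matrix A B C D =
    (\<chi> p q. case p of
        Inl i \<Rightarrow> (case q of Inl k \<Rightarrow> A $ i $ k | Inr k \<Rightarrow> B $ i $ k)
      | Inr i \<Rightarrow> (case q of Inl k \<Rightarrow> C $ i $ k | Inr k \<Rightarrow> D $ i $ k))"

definition block_col ::
  "complex ^ 'k ^ 'm1 \<Rightarrow> complex ^ 'k ^ 'm2 \<Rightarrow> complex ^ 'k ^ ('m1 + 'm2)"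
  where "block_col A C = (\<chi> p. case p of Inl i \<Rightarrow> A $ i | Inr i \<Rightarrow> C $ i)"

definition block21 :: "complex ^ ('m1::finite + 'm2::finite) ^ ('m1 + 'm2) \<Rightarrow> complex ^ 'm1 ^ 'm2"
  where "block21 A = (\<chi> i k. A $ Inr i $ Inl k)"

definition block22 :: "complex ^ ('m1::finite + 'm2::finite) ^ ('m1 + 'm2) \<Rightarrow> complex ^ 'm2 ^ 'm2"
  where "block22 A = (\<chi> i k. A $ Inr i $ Inr k)"

definition jmat :: "complex ^ ('m1::finite + 'm2::finite) ^ ('m1 + 'm2)"
  where "jmat = block_matrix (mat 1) 0 0 (- mat 1)"

definition Vmat ::
  "(real \<Rightarrow> real \<Rightarrow> complex ^ 'm2 ^ 'm1) \<Rightarrow> real \<Rightarrow> real \<Rightarrow> complex ^ ('m1 + 'm2) ^ ('m1 + 'm2)"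
  where "Vmat v x t = block_matrix 0 (v x t) (ctranspose (v x t)) 0"

text \<open>Partial derivatives on the closed quarter-plane; taking the derivative within \<open>{0..}\<close> makes
  them one-sided on the boundary.\<close>

definition partial_x :: "(real \<Rightarrow> real \<Rightarrow> 'a) \<Rightarrow> real \<Rightarrow> real \<Rightarrow> 'a :: real_normed_vector"
  where "partial_x f x t = vector_derivative (\<lambda>s. f s t) (at x within {0..})"

definition partial_t :: "(real \<Rightarrow> real \<Rightarrow> 'a) \<Rightarrow> real \<Rightarrow> real \<Rightarrow> 'a :: real_normed_vector"
  where "partial_t f x t = vector_derivative (\<lambda>s. f x s) (at t within {0..})"

definition has_partial_x :: "(real \<Rightarrow> real \<Rightarrow> 'a :: real_normed_vector) \<Rightarrow> bool"
  where "has_partial_x f \<longleftrightarrow>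
    (\<forall>x\<ge>0. \<forall>t\<ge>0. (\<lambda>s. f s t) differentiable (at x within {0..}))"

definition has_partial_t :: "(real \<Rightarrow> real \<Rightarrow> 'a :: real_normed_vector) \<Rightarrow> bool"
  where "has_partial_t f \<longleftrightarrow>
    (\<forall>x\<ge>0. \<forall>t\<ge>0. (\<lambda>s. f x s) differentiable (at t within {0..}))"

definition continuously_differentiable :: "(real \<Rightarrow> real \<Rightarrow> 'a :: real_normed_vector) \<Rightarrow> bool"
  where "continuously_differentiable f \<longleftrightarrow>
    has_partial_x f \<and> has_partial_t f \<and>
    continuous_on ({0..} \<times> {0..}) (\<lambda>(x, t). partial_x f x t) \<and>
    continuous_on ({0..} \<times> {0..}) (\<lambda>(x, t). partial_t f x t)"

definition focusing_nls :: "(real \<Rightarrow> real \<Rightarrow> complex ^ 'm2 ^ 'm1) \<Rightarrow> bool"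
  where "focusing_nls v \<longleftrightarrow>
    (\<forall>x\<ge>0. \<forall>t\<ge>0.
      2 \<cdot>\<^sub>c partial_t v x t
        + \<i> \<cdot>\<^sub>c (partial_x (partial_x v) x t + 2 \<cdot>\<^sub>c (v x t ** ctranspose (v x t) ** v x t)) = 0)"

definition Fmat ::
  "(real \<Rightarrow> real \<Rightarrow> complex ^ 'm2 ^ 'm1) \<Rightarrow> real \<Rightarrow> real \<Rightarrow> complex
    \<Rightarrow> complex ^ ('m1 + 'm2) ^ ('m1 + 'm2)"
  where "Fmat v x t z =
    \<i> \<cdot>\<^sub>c (z\<^sup>2 \<cdot>\<^sub>c jmat - (\<i> * z) \<cdot>\<^sub>c (jmat ** Vmat v x t)
      - (1 / 2) \<cdot>\<^sub>c (partial_x (Vmat v) x t + jmat ** (Vmat v x t ** Vmat v x t)))"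

definition normalized_fundamental_solution ::
  "(real \<Rightarrow> complex \<Rightarrow> complex ^ 'n ^ 'n) \<Rightarrow> (real \<Rightarrow> complex \<Rightarrow> complex ^ 'n ^ 'n) \<Rightarrow> bool"
  where "normalized_fundamental_solution A u \<longleftrightarrow>
    (\<forall>z. u 0 z = mat 1 \<and>
      (\<forall>s\<ge>0. ((\<lambda>r. u r z) has_vector_derivative A s z ** u s z) (at s within {0..})))"

definition dirac_coeff ::
  "(real \<Rightarrow> real \<Rightarrow> complex ^ 'm2 ^ 'm1) \<Rightarrow> real \<Rightarrow> complex \<Rightarrow> complex ^ ('m1 + 'm2) ^ ('m1 + 'm2)"
  where "dirac_coeff v x z = (\<i> * z) \<cdot>\<^sub>c jmat + jmat ** Vmat v x 0"

text \<open>Here \<open>u\<close> is the normalized fundamental solution of the Dirac system. The integrand is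
  positive semidefinite, so finiteness of its integral is Lebesgue integrability.\<close>

definition weyl_function ::
  "(real \<Rightarrow> complex \<Rightarrow> complex ^ ('m1 + 'm2) ^ ('m1 + 'm2)) \<Rightarrow> real
    \<Rightarrow> (complex \<Rightarrow> complex ^ 'm1 ^ 'm2) \<Rightarrow> bool"
  where "weyl_function u M \<phi> \<longleftrightarrow>
    (\<forall>i k. (\<lambda>z. \<phi> z $ i $ k) holomorphic_on {z. Im z > M}) \<and>
    (\<forall>z. Im z > M \<longrightarrow>
      set_integrable lborel {0..}
        (\<lambda>x. ctranspose (block_col (mat 1) (\<phi> z)) ** ctranspose (u x z) ** u x z
              ** block_col (mat 1) (\<phi> z)))"

end

theory Submission
  imports Defs
begin

text \<open>
  Write \<open>w = R(t,z) [I; \<phi>(0,z)] c\<close>. By the zero curvature equation, \<open>w\<close> is the trace at \<open>x = 0\<close> of a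
  function \<open>y(x,t)\<close> which solves the Dirac system in \<open>x\<close> and the system with coefficient \<open>F\<close> in \<open>t\<close>
  and which agrees with the Weyl solution at \<open>t = 0\<close>. The bounds on \<open>v\<close> and \<open>v\<^sub>x\<close> keep \<open>y\<close>
  square integrable in \<open>x\<close> at each time. The indefinite form \<open>y\<^sup>* j y\<close> decreases in \<open>x\<close> when
  \<open>Im z > M\<close>, so if it were negative at \<open>x = 0\<close>, then \<open>\<bar>y\<bar>\<close> would be bounded away from \<open>0\<close>;
  hence \<open>w\<^sup>* j w \<ge> 0\<close> for all \<open>t\<close>.

  At \<open>x = 0\<close> the form also decreases in \<open>t\<close>, with rate at least \<open>\<bar>y\<bar>\<^sup>2\<close>, once \<open>Re z\<close> and
  \<open>Im z\<close> are large. Therefore \<open>w\<close>, on which the form stays nonnegative, is bounded, while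
  \<open>\<bar>R\<^sub>2\<^sub>2 q\<bar> \<ge> exp (t / 2) \<bar>q\<bar>\<close>. The lower block of \<open>w\<close> is \<open>R\<^sub>2\<^sub>2 (\<phi> + R\<^sub>2\<^sub>2\<^sup>-\<^sup>1 R\<^sub>2\<^sub>1) c\<close>,
  and so \<open>\<phi> + R\<^sub>2\<^sub>2\<^sup>-\<^sup>1 R\<^sub>2\<^sub>1\<close> tends to \<open>0\<close>.
\<close>

section \<open>Linear differential systems with a parameter\<close>

lemma bounded_bilinear_matrix_vector_mult:
  "bounded_bilinear ((*v) :: complex ^ 'n ^ 'm \<Rightarrow> complex ^ 'n \<Rightarrow> complex ^ 'm)"
  unfolding bilinear_conv_bounded_bilinear [symmetric] bilinear_def linear_iff
  by (simp add: matrix_vector_mult_def vec_eq_iff sum.distrib algebra_simps scaleR_sum_right)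

lemma bounded_bilinear_matrix_matrix_mult:
  "bounded_bilinear ((**) :: complex ^ 'n ^ 'm \<Rightarrow> complex ^ 'k ^ 'n \<Rightarrow> complex ^ 'k ^ 'm)"
  unfolding bilinear_conv_bounded_bilinear [symmetric] bilinear_def linear_iff
  by (simp add: matrix_matrix_mult_def vec_eq_iff sum.distrib algebra_simps scaleR_sum_right)

lemmas continuous_on_matrix_vector_mult [continuous_intros] =
  bounded_bilinear.continuous_on [OF bounded_bilinear_matrix_vector_mult]

lemmas continuous_on_matrix_matrix_mult [continuous_intros] =
  bounded_bilinear.continuous_on [OF bounded_bilinear_matrix_matrix_mult]

lemma continuous_on_prod_slices:
  assumes "continuous_on (A \<times> B) (\<lambda>(s, t). k s t)"
  shows "t \<in> B \<Longrightarrow> continuous_on A (\<lambda>s. k s t)"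
    and "s \<in> A \<Longrightarrow> continuous_on B (\<lambda>t. k s t)"
proof -
  show "continuous_on A (\<lambda>s. k s t)" if "t \<in> B"
    using continuous_on_compose2 [OF assms, of A "\<lambda>s. (s, t)"] that
    by (simp add: continuous_on_Pair image_subset_iff)
  show "continuous_on B (\<lambda>t. k s t)" if "s \<in> A"
    using continuous_on_compose2 [OF assms, of B "\<lambda>t. (s, t)"] that
    by (simp add: continuous_on_Pair image_subset_iff)
qed

lemma has_vector_derivative_nonpos_imp_le:
  fixes f :: "real \<Rightarrow> real"
  assumes "a \<le> b"
    and f: "\<And>x. x \<in> {a..b} \<Longrightarrow> (f has_vector_derivative f' x) (at x within {a..b})"
    and "\<And>x. x \<in> {a..b} \<Longrightarrow> f' x \<le> 0"
  shows "f b \<le> f a"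
proof (cases "a < b")
  case True
  have c: "continuous_on {a..b} f"
    using f by (rule continuous_on_vector_derivative)
  have "\<exists>y. DERIV f x :> y \<and> y \<le> 0" if "a < x" "x < b" for x
    using f [of x] assms(3) [of x] that
    by (auto simp: at_within_Icc_at has_real_derivative_iff_has_vector_derivative)
  with True c show ?thesis
    by (intro DERIV_nonpos_imp_decreasing_open [of a b f]) auto
qed (use assms in auto)

text \<open>Substituting \<open>x * s\<close> for \<open>s\<close> moves the integral to the fixed
  interval [0, 1], where continuity of parametric integrals applies with the pair
  \<open>(x, t)\<close> as parameter.\<close>

lemma integral_indefinite_continuous_on_param:
  fixes k :: "real \<Rightarrow> real \<Rightarrow> 'a :: banach"
  assumes k: "continuous_on ({0..X} \<times> P) (\<lambda>(s, t). k s t)"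
  shows "continuous_on ({0..X} \<times> P) (\<lambda>(x, t). integral {0..x} (\<lambda>s. k s t))"
proof -
  have eq: "integral {0..x} (\<lambda>s. k s t) = x *\<^sub>R integral (cbox 0 1) (\<lambda>s. k (x * s) t)"
    if "x \<in> {0..X}" "t \<in> P" for x t
  proof (cases "x = 0")
    case False
    with that have x: "x > 0" by auto
    have "continuous_on {0..x} (\<lambda>s. k s t)"
      using that by (intro continuous_on_subset [OF continuous_on_prod_slices(1) [OF k]]) auto
    then have "((\<lambda>s. k s t) has_integral integral {0..x} (\<lambda>s. k s t)) (cbox 0 x)"
      by (simp add: integrable_continuous_real integrable_integral)
    from has_integral_affinity' [OF this x, of 0]
    have "((\<lambda>s. k (x * s) t) has_integral (integral {0..x} (\<lambda>s. k s t) /\<^sub>R x)) (cbox 0 1)"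
      using x by simp
    with x show ?thesis
      by (simp add: integral_unique)
  qed auto
  have range: "x * s \<in> {0..X}" if "x \<in> {0..X}" "s \<in> {0..1}" for x s
    using that mult_left_le [of s x] by (auto simp: mult.commute)
  have "continuous_on (({0..X} \<times> P) \<times> cbox 0 1) (\<lambda>q. k (fst (fst q) * snd q) (snd (fst q)))"
    using continuous_on_compose2 [OF k, of "({0..X} \<times> P) \<times> cbox 0 1"
        "\<lambda>q. (fst (fst q) * snd q, snd (fst q))"] range
    by (simp add: image_subset_iff continuous_on_Pair continuous_on_mult continuous_on_fst
        continuous_on_snd)
  then have "continuous_on ({0..X} \<times> P)
      (\<lambda>p. integral (cbox 0 1) (\<lambda>s. k (fst p * s) (snd p)))"
    by (intro integral_continuous_on_param) (simp add: o_def case_prod_unfold)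
  then have "continuous_on ({0..X} \<times> P)
      (\<lambda>p. fst p *\<^sub>R integral (cbox 0 1) (\<lambda>s. k (fst p * s) (snd p)))"
    by (intro continuous_intros)
  then show ?thesis
    by (rule continuous_on_eq) (auto simp: eq)
qed

lemma bounded_on_compact_matrix:
  fixes A :: "'p :: metric_space \<Rightarrow> complex ^ 'n ^ 'm"
  assumes "compact S" "continuous_on S A"
  obtains C where "C > 0" "\<And>p a. p \<in> S \<Longrightarrow> norm (A p *v a) \<le> C * norm a"
proof -
  obtain B where B: "B > 0" "\<And>p. p \<in> S \<Longrightarrow> norm (A p) \<le> B"
    using compact_imp_bounded [OF compact_continuous_image [OF assms(2,1)]]
    unfolding bounded_pos by auto
  obtain K where K: "K > 0"
    "\<And>(A :: complex ^ 'n ^ 'm) a. norm (A *v a) \<le> norm A * norm a * K"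
    using bounded_bilinear.pos_bounded [OF bounded_bilinear_matrix_vector_mult] by blast
  show ?thesis
  proof
    show "B * K > 0" using B K by simp
    fix p and a :: "complex ^ 'n" assume "p \<in> S"
    then have "norm (A p) * norm a * K \<le> B * norm a * K"
      using B K by (intro mult_right_mono) auto
    then show "norm (A p *v a) \<le> B * K * norm a"
      using K(2) [of "A p" a] by (simp add: algebra_simps)
  qed
qed

text \<open>The Picard operator acts on functions of both variables, so all values of
  \<open>t\<close> are treated at once and joint continuity of \<open>y\<close> comes with the fixed
  point. Since \<open>w\<close> is merely continuous, nothing is claimed here about derivatives in
  \<open>t\<close>; those are supplied by \<open>zero_curvature_flow\<close>.\<close>

lemma linear_system_exists:
  fixes G :: "real \<Rightarrow> real \<Rightarrow> complex ^ 'n ^ 'n" and w :: "real \<Rightarrow> complex ^ 'n"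
  assumes XT: "0 \<le> X" "0 \<le> T"
    and G: "continuous_on ({0..X} \<times> {0..T}) (\<lambda>(x, t). G x t)"
    and w: "continuous_on {0..T} w"
  obtains y where "continuous_on ({0..X} \<times> {0..T}) (\<lambda>(x, t). y x t)"
    and "\<And>t. t \<in> {0..T} \<Longrightarrow> y 0 t = w t"
    and "\<And>x t. x \<in> {0..X} \<Longrightarrow> t \<in> {0..T} \<Longrightarrow>
      ((\<lambda>s. y s t) has_vector_derivative G x t *v y x t) (at x within {0..X})"
proof -
  define Q where "Q = {0..X} \<times> {0..T}"
  have Q: "Q = cbox (0, 0) (X, T)"
    by (simp add: Q_def cbox_Pair_eq)
  have "compact Q"
    by (simp add: Q_def compact_Times)
  then obtain C where "C > 0"
    and "\<And>p a. p \<in> Q \<Longrightarrow> norm ((case p of (x, t) \<Rightarrow> G x t) *v a) \<le> C * norm a"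
    using bounded_on_compact_matrix [OF _ G [folded Q_def]] by blast
  then have C: "C > 0" "\<And>x t a. x \<in> {0..X} \<Longrightarrow> t \<in> {0..T} \<Longrightarrow>
      norm (G x t *v a) \<le> C * norm a"
    by (force simp: Q_def)+
  \<comment> \<open>The unknown is \<open>f = exp (- 2 C x) y\<close>: with this weight the Picard operator is a contraction on
    the whole rectangle. Clamping the argument makes it act on bounded continuous functions.\<close>
  define k where "k f s t = exp (2 * C * s) *\<^sub>R (G s t *v f (s, t))"
    for f :: "real \<times> real \<Rightarrow> complex ^ 'n" and s t
  define H where "H f = (\<lambda>(x, t). exp (- (2 * C * x)) *\<^sub>R (w t + integral {0..x} (\<lambda>s. k f s t)))"
    for f
  define c where "c = clamp (0, 0) (X, T)"
  have c_in: "c p \<in> Q" for p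
    unfolding c_def Q using XT by (intro clamp_in_interval) (auto simp: Basis_prod_def)
  have c_id: "c p = p" if "p \<in> Q" for p
    using that unfolding c_def Q by (rule clamp_cancel_cbox)
  have k_cont: "continuous_on Q (\<lambda>(s, t). k f s t)" if "continuous_on Q f" for f
    using G that unfolding k_def Q_def case_prod_unfold
    by (auto intro!: continuous_intros)
  have H_cont: "continuous_on Q (H f)" if "continuous_on Q f" for f
    using integral_indefinite_continuous_on_param [OF k_cont [OF that, unfolded Q_def]]
    unfolding H_def Q_def case_prod_unfold
    by (auto intro!: continuous_intros continuous_on_compose2 [OF w])
  have cont_b: "continuous_on S (apply_bcontfun f)" for S and f :: "(real \<times> real) \<Rightarrow>\<^sub>C (complex ^ 'n)"
    using continuous_on_apply_bcontfun [of UNIV f] by (rule continuous_on_subset) auto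
  define \<Phi> where "\<Phi> f = Bcontfun (\<lambda>p. H (apply_bcontfun f) (c p))" for f
  have \<Phi>: "apply_bcontfun (\<Phi> f) p = H (apply_bcontfun f) (c p)" for f p
  proof -
    have "continuous_on (cbox (0, 0) (X, T)) (H (apply_bcontfun f))"
      using H_cont [OF cont_b] by (simp add: Q)
    moreover from this have "bounded (H (apply_bcontfun f) ` cbox (0, 0) (X, T))"
      by (intro compact_imp_bounded compact_continuous_image) auto
    ultimately have "(\<lambda>p. H (apply_bcontfun f) (c p)) \<in> bcontfun"
      unfolding bcontfun_def c_def using clamp_continuous_on clamp_bounded by blast
    then show ?thesis
      by (simp add: \<Phi>_def Bcontfun_inverse)
  qed
  have int: "(\<lambda>s. k f s t) integrable_on {0..x}"
    if "continuous_on Q f" "x \<in> {0..X}" "t \<in> {0..T}" for f x t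
    using that by (intro integrable_continuous_real
        continuous_on_subset [OF continuous_on_prod_slices(1) [OF k_cont [OF that(1), unfolded Q_def]]]) auto
  have contr: "dist (\<Phi> f) (\<Phi> g) \<le> 1 / 2 * dist f g" for f g
  proof (rule dist_bound)
    fix p
    obtain x t where p: "c p = (x, t)" by force
    then have xt: "x \<in> {0..X}" "t \<in> {0..T}"
      using c_in [of p] by (auto simp: Q_def)
    let ?d = "dist f g"
    \<comment> \<open>The exponent of the weight is twice the Lipschitz constant \<open>C\<close>,
      so this primitive carries the factor \<open>C / (2 * C)\<close>: it is the source of the
      contraction constant 1/2.\<close>
    have ie: "((\<lambda>s. C * ?d * exp (2 * C * s)) has_integral
        (?d / 2 * exp (2 * C * x) - ?d / 2 * exp (2 * C * 0))) {0..x}"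
      using xt C(1) by (intro fundamental_theorem_of_calculus)
        (auto intro!: derivative_eq_intros simp flip: has_real_derivative_iff_has_vector_derivative)
    have "norm (integral {0..x} (\<lambda>s. k f s t) - integral {0..x} (\<lambda>s. k g s t))
        = norm (integral {0..x} (\<lambda>s. k f s t - k g s t))"
      using int [OF cont_b] xt by (simp add: integral_diff)
    also have "\<dots> \<le> integral {0..x} (\<lambda>s. C * ?d * exp (2 * C * s))"
    proof (rule integral_norm_bound_integral)
      show "(\<lambda>s. k f s t - k g s t) integrable_on {0..x}"
        using int [OF cont_b] xt by (intro integrable_diff) auto
      show "(\<lambda>s. C * ?d * exp (2 * C * s)) integrable_on {0..x}"
        using ie by blast
      fix s assume s: "s \<in> {0..x}"
      have "norm (k f s t - k g s t) = exp (2 * C * s) * norm (G s t *v (f (s, t) - g (s, t)))"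
        unfolding k_def by (simp flip: scaleR_diff_right matrix_vector_mult_diff_distrib)
      also have "\<dots> \<le> exp (2 * C * s) * (C * ?d)"
        using s xt C(1) dist_bounded [of f "(s, t)" g]
        by (intro mult_left_mono order_trans [OF C(2)]) (auto simp: dist_norm)
      finally show "norm (k f s t - k g s t) \<le> C * ?d * exp (2 * C * s)"
        by (simp add: mult.commute)
    qed
    also have "\<dots> \<le> ?d / 2 * exp (2 * C * x)"
      unfolding integral_unique [OF ie] by simp
    finally have *: "norm (integral {0..x} (\<lambda>s. k f s t) - integral {0..x} (\<lambda>s. k g s t))
      \<le> ?d / 2 * exp (2 * C * x)" .
    have "dist (\<Phi> f p) (\<Phi> g p)
        = exp (- (2 * C * x)) * norm (integral {0..x} (\<lambda>s. k f s t) - integral {0..x} (\<lambda>s. k g s t))"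
      by (simp add: \<Phi> p H_def dist_norm flip: scaleR_diff_right)
    also have "\<dots> \<le> exp (- (2 * C * x)) * (?d / 2 * exp (2 * C * x))"
      by (intro mult_left_mono *) auto
    also have "\<dots> = 1 / 2 * ?d"
      by (simp add: exp_minus)
    finally show "dist (\<Phi> f p) (\<Phi> g p) \<le> 1 / 2 * dist f g" .
  qed
  have "\<exists>!f. \<Phi> f = f"
    using contr by (intro banach_fix_type [of "1 / 2"]) auto
  then obtain f where f: "\<Phi> f = f" by blast
  define y where "y x t = exp (2 * C * x) *\<^sub>R f (x, t)" for x t
  have k_y: "k f s t = G s t *v y s t" for s t
    by (simp add: k_def y_def bounded_bilinear.scaleR_right [OF bounded_bilinear_matrix_vector_mult])
  have y: "y x t = w t + integral {0..x} (\<lambda>s. G s t *v y s t)"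
    if "x \<in> {0..X}" "t \<in> {0..T}" for x t
  proof -
    have "f (x, t) = H f (x, t)"
      using \<Phi> [of f "(x, t)"] that by (simp add: f c_id Q_def)
    then show ?thesis
      by (simp add: y_def [of x t] H_def k_y exp_minus)
  qed
  show ?thesis
  proof
    show y_cont: "continuous_on ({0..X} \<times> {0..T}) (\<lambda>(x, t). y x t)"
      unfolding y_def case_prod_unfold by (auto intro!: continuous_intros cont_b)
    show "y 0 t = w t" if "t \<in> {0..T}" for t
      using y [of 0 t] XT that by simp
    fix x t assume xt: "x \<in> {0..X}" "t \<in> {0..T}"
    have "continuous_on {0..X} (\<lambda>s. G s t *v y s t)"
      using continuous_on_prod_slices(1) [OF k_cont [OF cont_b, unfolded Q_def] xt(2), of f]
      by (simp add: k_y)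
    from integral_has_vector_derivative [OF this xt(1)]
    have "((\<lambda>s. w t + integral {0..s} (\<lambda>s. G s t *v y s t)) has_vector_derivative G x t *v y x t)
        (at x within {0..X})"
      by (auto intro!: derivative_eq_intros)
    then show "((\<lambda>s. y s t) has_vector_derivative G x t *v y x t) (at x within {0..X})"
      by (rule has_vector_derivative_transform [OF xt(1), rotated]) (use y xt in auto)
  qed
qed

section \<open>Differential inequalities of Gronwall type\<close>

lemma has_vector_derivative_inner:
  fixes f g :: "real \<Rightarrow> 'a :: real_inner"
  assumes "(f has_vector_derivative f') (at x within S)" "(g has_vector_derivative g') (at x within S)"
  shows "((\<lambda>x. f x \<bullet> g x) has_vector_derivative (f x \<bullet> g' + f' \<bullet> g x)) (at x within S)"
  using bounded_bilinear.has_vector_derivative [OF bounded_bilinear_inner assms] .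

text \<open>Gronwall's argument: \<open>exp (- (K * t)) * f t\<close> has nonpositive derivative.
  The function \<open>f\<close> may be negative, as it is when this is applied to the indefinite
  form.\<close>

lemma exponential_bound:
  fixes f :: "real \<Rightarrow> real"
  assumes "a \<le> b"
    and f: "\<And>t. t \<in> {a..b} \<Longrightarrow> (f has_vector_derivative f' t) (at t within {a..b})"
    and le: "\<And>t. t \<in> {a..b} \<Longrightarrow> f' t \<le> K * f t"
  shows "f b \<le> exp (K * (b - a)) * f a"
proof -
  have "exp (- (K * b)) * f b \<le> exp (- (K * a)) * f a"
  proof (rule has_vector_derivative_nonpos_imp_le [OF \<open>a \<le> b\<close>])
    fix t assume t: "t \<in> {a..b}"
    have "(f has_field_derivative f' t) (at t within {a..b})"
      using f [OF t] by (simp add: has_real_derivative_iff_has_vector_derivative)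
    then show "((\<lambda>t. exp (- (K * t)) * f t) has_vector_derivative
        exp (- (K * t)) * (f' t - K * f t)) (at t within {a..b})"
      unfolding has_real_derivative_iff_has_vector_derivative [symmetric]
      by (auto intro!: derivative_eq_intros simp: algebra_simps)
    show "exp (- (K * t)) * (f' t - K * f t) \<le> 0"
      using le [OF t] by (simp add: mult_le_0_iff)
  qed
  then have "exp (K * b) * (exp (- (K * b)) * f b) \<le> exp (K * b) * (exp (- (K * a)) * f a)"
    by (intro mult_left_mono) auto
  then show ?thesis
    by (simp add: exp_minus exp_diff right_diff_distrib field_simps)
qed

text \<open>The derivative of the squared norm is at most \<open>2 * K\<close> times itself. This
  serves both as a uniqueness statement, when \<open>y 0 = 0\<close>, and to compare the norms of
  one solution at two times.\<close>

lemma linear_system_growth: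
  fixes y :: "real \<Rightarrow> complex ^ 'n"
  assumes "0 \<le> T"
    and y: "\<And>t. t \<in> {0..T} \<Longrightarrow> (y has_vector_derivative A t *v y t) (at t within {0..T})"
    and A: "\<And>t. t \<in> {0..T} \<Longrightarrow> norm (A t *v y t) \<le> K * norm (y t)"
  shows "(norm (y T))\<^sup>2 \<le> exp (2 * K * T) * (norm (y 0))\<^sup>2"
proof -
  have "y T \<bullet> y T \<le> exp (2 * K * (T - 0)) * (y 0 \<bullet> y 0)"
  proof (rule exponential_bound [OF \<open>0 \<le> T\<close> has_vector_derivative_inner [OF y y]])
    fix t assume t: "t \<in> {0..T}"
    have "y t \<bullet> (A t *v y t) \<le> norm (y t) * norm (A t *v y t)"
      by (rule norm_cauchy_schwarz)
    also have "\<dots> \<le> norm (y t) * (K * norm (y t))"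
      using A [OF t] by (intro mult_left_mono) auto
    finally show "y t \<bullet> (A t *v y t) + (A t *v y t) \<bullet> y t \<le> 2 * K * (y t \<bullet> y t)"
      by (simp add: inner_commute dot_square_norm power2_eq_square ac_simps)
  qed
  then show ?thesis
    by (simp add: dot_square_norm)
qed

lemma has_vector_derivative_matrix_solution:
  fixes A U :: "real \<Rightarrow> complex ^ 'n ^ 'n"
  assumes "(U has_vector_derivative A t ** U t) (at t within S)"
  shows "((\<lambda>t. U t *v a) has_vector_derivative A t *v (U t *v a)) (at t within S)"
  using bounded_linear.has_vector_derivative [OF bounded_bilinear.bounded_linear_left
      [OF bounded_bilinear_matrix_vector_mult] assms]
  by (simp add: matrix_vector_mul_assoc)

section \<open>Compatibility of the systems in \<open>x\<close> and in \<open>t\<close>\<close>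

text \<open>\<open>curv\<close> says that the two mixed derivatives of a common solution would
  agree. It propagates the equation in \<open>t\<close> from the edge \<open>x = 0\<close>, where it
  is assumed, to the whole rectangle: \<open>q\<close> is the function obtained by integrating
  \<open>F y\<close> in time, and it is shown to coincide with \<open>y\<close>.\<close>

lemma zero_curvature_flow:
  fixes G F G' F' :: "real \<Rightarrow> real \<Rightarrow> complex ^ 'n ^ 'n" and y :: "real \<Rightarrow> real \<Rightarrow> complex ^ 'n"
  assumes XT: "0 \<le> X" "0 \<le> T"
    and G: "continuous_on ({0..X} \<times> {0..T}) (\<lambda>(x, t). G x t)"
    and G': "continuous_on ({0..X} \<times> {0..T}) (\<lambda>(x, t). G' x t)"
    and F: "continuous_on ({0..X} \<times> {0..T}) (\<lambda>(x, t). F x t)"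
    and F': "continuous_on ({0..X} \<times> {0..T}) (\<lambda>(x, t). F' x t)"
    and G_t: "\<And>x t. x \<in> {0..X} \<Longrightarrow> t \<in> {0..T} \<Longrightarrow>
      ((\<lambda>t. G x t) has_vector_derivative G' x t) (at t within {0..T})"
    and F_x: "\<And>x t. x \<in> {0..X} \<Longrightarrow> t \<in> {0..T} \<Longrightarrow>
      ((\<lambda>x. F x t) has_vector_derivative F' x t) (at x within {0..X})"
    and curv: "\<And>x t. x \<in> {0..X} \<Longrightarrow> t \<in> {0..T} \<Longrightarrow>
      G' x t + G x t ** F x t = F' x t + F x t ** G x t"
    and y: "continuous_on ({0..X} \<times> {0..T}) (\<lambda>(x, t). y x t)"
    and y_x: "\<And>x t. x \<in> {0..X} \<Longrightarrow> t \<in> {0..T} \<Longrightarrow>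
      ((\<lambda>x. y x t) has_vector_derivative G x t *v y x t) (at x within {0..X})"
    and y_0: "\<And>t. t \<in> {0..T} \<Longrightarrow>
      ((\<lambda>t. y 0 t) has_vector_derivative F 0 t *v y 0 t) (at t within {0..T})"
    and xt: "x \<in> {0..X}" "t \<in> {0..T}"
  shows "((\<lambda>t. y x t) has_vector_derivative F x t *v y x t) (at t within {0..T})"
proof -
  define Q where "Q = {0..X} \<times> {0..T}"
  note bb = bounded_bilinear_matrix_vector_mult [where 'n = 'n and 'm = 'n]
  have Q: "compact Q"
    by (simp add: Q_def compact_Times)
  have Fy: "continuous_on Q (\<lambda>(x, t). F x t *v y x t)"
    using F y unfolding Q_def case_prod_unfold by (intro continuous_intros)
  define I where "I x t = integral {0..t} (\<lambda>\<tau>. F x \<tau> *v y x \<tau>)" for x t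
  define q where "q x t = y x 0 + I x t" for x t
  \<comment> \<open>The zero curvature equation turns the Dirac equation for \<open>y\<close> into a homogeneous
    integro-differential equation in \<open>x\<close> for the defect \<open>D\<close>, which vanishes at \<open>x = 0\<close>; no
    derivative of \<open>y\<close> with respect to the parameter \<open>t\<close> has to be known to exist.\<close>
  define D where "D x t = y x t - q x t" for x t
  have I: "continuous_on Q (\<lambda>(x, t). I x t)"
    unfolding I_def Q_def using Fy [unfolded Q_def]
    by (rule continuous_on_swap_args [OF integral_indefinite_continuous_on_param
          [OF continuous_on_swap_args]])
  have y0: "continuous_on Q (\<lambda>(x, t). y x 0)"
    using continuous_on_compose2 [OF continuous_on_prod_slices(1) [OF y], of 0 Q fst] XT
    by (simp add: case_prod_unfold Q_def continuous_on_fst image_subset_iff)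
  have q: "continuous_on Q (\<lambda>(x, t). q x t)"
    using I y0 unfolding q_def case_prod_unfold by (intro continuous_intros)
  have D: "continuous_on Q (\<lambda>(x, t). D x t)"
    using q y unfolding D_def case_prod_unfold Q_def by (intro continuous_intros)
  have D0: "D 0 t = 0" if "t \<in> {0..T}" for t
  proof -
    have "((\<lambda>\<tau>. F 0 \<tau> *v y 0 \<tau>) has_integral (y 0 t - y 0 0)) {0..t}"
      using that
      by (intro fundamental_theorem_of_calculus has_vector_derivative_within_subset [OF y_0]) auto
    then show ?thesis
      by (simp add: D_def q_def I_def integral_unique)
  qed
  have q_t: "((\<lambda>t. q x t) has_vector_derivative F x t *v y x t) (at t within {0..T})"
    if "x \<in> {0..X}" "t \<in> {0..T}" for x t
    using integral_has_vector_derivative [OF continuous_on_prod_slices(2) [OF Fy [unfolded Q_def]]] that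
    unfolding q_def I_def by (auto intro!: derivative_eq_intros)
  have G'D: "continuous_on Q (\<lambda>(x, t). G' x t *v D x t)"
    using G' D unfolding Q_def case_prod_unfold by (intro continuous_intros)
  have int_G'D: "(\<lambda>\<tau>. G' x \<tau> *v D x \<tau>) integrable_on {0..t}"
    if "x \<in> {0..X}" "t \<in> {0..T}" for x t
    using that by (intro integrable_continuous_real continuous_on_subset
        [OF continuous_on_prod_slices(2) [OF G'D [unfolded Q_def]]]) auto
  have D_x: "((\<lambda>x. D x t) has_vector_derivative
        (G x t *v D x t - integral {0..t} (\<lambda>\<tau>. G' x \<tau> *v D x \<tau>))) (at x within {0..X})"
    if xt: "x \<in> {0..X}" "t \<in> {0..T}" for x t
  proof -
    \<comment> \<open>\<open>J\<close> is the derivative of \<open>F y\<close> in \<open>x\<close>.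
      As \<open>q\<close> has time derivative \<open>F y\<close>, the curvature equation turns
      \<open>J\<close> into the time derivative of \<open>G q\<close> plus \<open>G' D\<close>, so
      its integral is a boundary term plus the integral of \<open>G' D\<close>.\<close>
    define J where "J x \<tau> = F x \<tau> *v (G x \<tau> *v y x \<tau>) + F' x \<tau> *v y x \<tau>" for x \<tau>
    have "((\<lambda>x. integral (cbox 0 t) (\<lambda>\<tau>. F x \<tau> *v y x \<tau>)) has_vector_derivative
        integral (cbox 0 t) (J x)) (at x within {0..X})"
    proof (rule leibniz_rule_vector_derivative [OF _ _ _ xt(1)])
      show "((\<lambda>x. F x \<tau> *v y x \<tau>) has_vector_derivative J x \<tau>) (at x within {0..X})"
        if "x \<in> {0..X}" "\<tau> \<in> cbox 0 t" for x \<tau>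
        using that xt unfolding J_def
        by (intro bounded_bilinear.has_vector_derivative [OF bb] F_x y_x) auto
      show "(\<lambda>\<tau>. F x \<tau> *v y x \<tau>) integrable_on cbox 0 t" if "x \<in> {0..X}" for x
        using xt by (intro integrable_continuous
            continuous_on_subset [OF continuous_on_prod_slices(2) [OF Fy [unfolded Q_def] that]]) auto
      have "continuous_on Q (\<lambda>(x, \<tau>). J x \<tau>)"
        using F G F' y unfolding J_def Q_def case_prod_unfold by (intro continuous_intros)
      then show "continuous_on ({0..X} \<times> cbox 0 t) (\<lambda>(x, \<tau>). J x \<tau>)"
        by (rule continuous_on_subset) (use xt in \<open>auto simp: Q_def\<close>)
    qed auto
    then have I_x: "((\<lambda>x. I x t) has_vector_derivative integral {0..t} (J x)) (at x within {0..X})"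
      by (simp add: I_def)
    have "((\<lambda>\<tau>. G x \<tau> *v (F x \<tau> *v y x \<tau>) + G' x \<tau> *v q x \<tau>) has_integral
        (G x t *v q x t - G x 0 *v q x 0)) {0..t}"
      using xt by (intro fundamental_theorem_of_calculus bounded_bilinear.has_vector_derivative [OF bb]
          has_vector_derivative_within_subset [OF G_t] has_vector_derivative_within_subset [OF q_t]) auto
    moreover have "(\<lambda>\<tau>. G' x \<tau> *v D x \<tau>) integrable_on {0..t}"
      using xt by (intro int_G'D) auto
    then have "((\<lambda>\<tau>. G' x \<tau> *v D x \<tau>) has_integral integral {0..t} (\<lambda>\<tau>. G' x \<tau> *v D x \<tau>)) {0..t}"
      by (rule integrable_integral)
    ultimately have "((\<lambda>\<tau>. (G x \<tau> *v (F x \<tau> *v y x \<tau>) + G' x \<tau> *v q x \<tau>) + G' x \<tau> *v D x \<tau>) has_integral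
        (G x t *v q x t - G x 0 *v q x 0) + integral {0..t} (\<lambda>\<tau>. G' x \<tau> *v D x \<tau>)) {0..t}"
      by (rule has_integral_add)
    moreover have "(G x \<tau> *v (F x \<tau> *v y x \<tau>) + G' x \<tau> *v q x \<tau>) + G' x \<tau> *v D x \<tau> = J x \<tau>"
      if "\<tau> \<in> {0..t}" for \<tau>
    proof -
      have "(G' x \<tau> + G x \<tau> ** F x \<tau>) *v y x \<tau> = (F' x \<tau> + F x \<tau> ** G x \<tau>) *v y x \<tau>"
        using curv [of x \<tau>] xt that by simp
      then show ?thesis
        by (simp add: J_def D_def matrix_vector_mult_add_rdistrib matrix_vector_mult_diff_distrib
            matrix_vector_mul_assoc algebra_simps)
    qed
    ultimately have "(J x has_integral
        (G x t *v q x t - G x 0 *v q x 0) + integral {0..t} (\<lambda>\<tau>. G' x \<tau> *v D x \<tau>)) {0..t}"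
      by (subst (asm) has_integral_cong) auto
    then have int_J: "integral {0..t} (J x)
        = (G x t *v q x t - G x 0 *v q x 0) + integral {0..t} (\<lambda>\<tau>. G' x \<tau> *v D x \<tau>)"
      by (rule integral_unique)
    have "q x 0 = y x 0"
      by (simp add: q_def I_def)
    then have "G x t *v D x t - integral {0..t} (\<lambda>\<tau>. G' x \<tau> *v D x \<tau>)
        = G x t *v y x t - (G x 0 *v y x 0 + integral {0..t} (J x))"
      unfolding int_J by (simp add: D_def matrix_vector_mult_diff_distrib)
    moreover have "((\<lambda>x. D x t) has_vector_derivative
        G x t *v y x t - (G x 0 *v y x 0 + integral {0..t} (J x))) (at x within {0..X})"
      unfolding D_def q_def using xt XT I_x
      by (intro has_vector_derivative_diff has_vector_derivative_add y_x) auto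
    ultimately show ?thesis by simp
  qed
  obtain C1 where "C1 > 0" and "\<And>p a. p \<in> Q \<Longrightarrow> norm ((case p of (x, t) \<Rightarrow> G x t) *v a) \<le> C1 * norm a"
    using bounded_on_compact_matrix [OF Q G [folded Q_def]] by blast
  then have C1: "C1 > 0" "\<And>x t a. x \<in> {0..X} \<Longrightarrow> t \<in> {0..T} \<Longrightarrow> norm (G x t *v a) \<le> C1 * norm a"
    by (force simp: Q_def)+
  obtain C2 where "C2 > 0" and "\<And>p a. p \<in> Q \<Longrightarrow> norm ((case p of (x, t) \<Rightarrow> G' x t) *v a) \<le> C2 * norm a"
    using bounded_on_compact_matrix [OF Q G' [folded Q_def]] by blast
  then have C2: "C2 > 0" "\<And>x t a. x \<in> {0..X} \<Longrightarrow> t \<in> {0..T} \<Longrightarrow> norm (G' x t *v a) \<le> C2 * norm a"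
    by (force simp: Q_def)+
  \<comment> \<open>\<open>C\<close> bounds the right-hand side of the equation for
    \<open>D\<close>: \<open>C1\<close> comes from \<open>G\<close>, and \<open>C2 * T\<close> from
    the integral of \<open>G' D\<close> over a time interval of length at most \<open>T\<close>.
    With the weight \<open>exp (- (2 * C * x))\<close>, integration in \<open>x\<close> halves the
    maximum \<open>N\<close> of the weighted defect, which forces \<open>N = 0\<close>.\<close>
  define C where "C = C1 + C2 * T"
  have "C > 0"
    using C1 C2 XT by (simp add: C_def add_pos_nonneg)
  define E where "E = (\<lambda>(x, t). exp (- (2 * C * x)) * norm (D x t))"
  have "continuous_on Q E"
    using D unfolding E_def case_prod_unfold by (intro continuous_intros)
  moreover have "Q \<noteq> {}"
    using XT by (auto simp: Q_def)
  ultimately obtain p where p: "p \<in> Q" "\<And>p'. p' \<in> Q \<Longrightarrow> E p' \<le> E p"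
    using continuous_attains_sup [OF Q] by blast
  define N where "N = E p"
  have N: "norm (D x t) \<le> N * exp (2 * C * x)" if "x \<in> {0..X}" "t \<in> {0..T}" for x t
    using p(2) [of "(x, t)"] that by (simp add: N_def E_def Q_def exp_minus field_simps)
  have "N \<ge> 0"
    by (simp add: N_def E_def case_prod_unfold)
  have D_bound: "norm (D x t) \<le> N / 2 * exp (2 * C * x)" if xt: "x \<in> {0..X}" "t \<in> {0..T}" for x t
  proof (cases "x = 0")
    case True
    then show ?thesis
      using D0 \<open>N \<ge> 0\<close> xt by simp
  next
    case False
    then have "0 < x" using xt by simp
    have "norm (D x t - D 0 t) \<le> N / 2 * exp (2 * C * x) - N / 2 * exp (2 * C * 0)"
    proof (rule differentiable_bound_general [OF \<open>0 < x\<close>])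
      show "continuous_on {0..x} (\<lambda>x. D x t)"
        using continuous_on_prod_slices(1) [OF D [unfolded Q_def] xt(2)]
        by (rule continuous_on_subset) (use xt in auto)
      show "continuous_on {0..x} (\<lambda>x. N / 2 * exp (2 * C * x))"
        by (intro continuous_intros)
      fix s assume s: "0 < s" "s < x"
      have "at s within {0..X} = at s"
        using s xt by (intro at_within_interior) auto
      with D_x [of s t] s xt
      show "((\<lambda>x. D x t) has_vector_derivative
          (G s t *v D s t - integral {0..t} (\<lambda>\<tau>. G' s \<tau> *v D s \<tau>))) (at s)"
        by auto
      show "((\<lambda>x. N / 2 * exp (2 * C * x)) has_vector_derivative N * C * exp (2 * C * s)) (at s)"
        by (auto intro!: derivative_eq_intros simp flip: has_real_derivative_iff_has_vector_derivative)
      have "norm (integral (cbox 0 t) (\<lambda>\<tau>. G' s \<tau> *v D s \<tau>)) \<le> (C2 * (N * exp (2 * C * s))) * measure lborel (cbox 0 t)"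
      proof (rule integrable_bound)
        show "0 \<le> C2 * (N * exp (2 * C * s))"
          using C2 \<open>N \<ge> 0\<close> by simp
        show "(\<lambda>\<tau>. G' s \<tau> *v D s \<tau>) integrable_on cbox 0 t"
          using int_G'D [of s t] xt s by simp
        show "norm (G' s \<tau> *v D s \<tau>) \<le> C2 * (N * exp (2 * C * s))" if "\<tau> \<in> cbox 0 t" for \<tau>
          using C2(1) s xt that
          by (intro order_trans [OF C2(2)] mult_left_mono N) auto
      qed
      also have "\<dots> \<le> (C2 * (N * exp (2 * C * s))) * T"
        using C2 \<open>N \<ge> 0\<close> xt by (intro mult_left_mono) auto
      finally have "norm (integral {0..t} (\<lambda>\<tau>. G' s \<tau> *v D s \<tau>)) \<le> C2 * T * (N * exp (2 * C * s))"
        by (simp add: ac_simps)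
      moreover have "norm (G s t *v D s t) \<le> C1 * (N * exp (2 * C * s))"
        using C1(1) s xt by (intro order_trans [OF C1(2)] mult_left_mono N) auto
      ultimately show "norm (G s t *v D s t - integral {0..t} (\<lambda>\<tau>. G' s \<tau> *v D s \<tau>))
          \<le> N * C * exp (2 * C * s)"
        by (intro order_trans [OF norm_triangle_ineq4]) (simp add: C_def algebra_simps)
    qed
    then show ?thesis
      using D0 \<open>N \<ge> 0\<close> xt by simp
  qed
  have "N \<le> N / 2"
    using D_bound [of "fst p" "snd p"] p(1)
    by (auto simp: N_def E_def Q_def exp_minus field_simps case_prod_unfold)
  then have "N = 0"
    using \<open>N \<ge> 0\<close> by simp
  then have y_q: "y x t = q x t" if "t \<in> {0..T}" for t
    using N [OF xt(1) that] by (simp add: D_def)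
  show ?thesis
    using q_t [OF xt] by (rule has_vector_derivative_transform [OF xt(2), rotated]) (use y_q in auto)
qed

section \<open>Block matrices and the indefinite form\<close>

lemma sum_UNIV_Plus:
  "sum f (UNIV :: ('a::finite + 'b::finite) set) = (\<Sum>i\<in>UNIV. f (Inl i)) + (\<Sum>k\<in>UNIV. f (Inr k))"
  using sum.Plus [of "UNIV :: 'a set" "UNIV :: 'b set" f] by (simp add: UNIV_Plus_UNIV)

lemma all_Plus: "(\<forall>p :: 'a + 'b. P p) \<longleftrightarrow> (\<forall>i. P (Inl i)) \<and> (\<forall>k. P (Inr k))"
  by (metis sum.exhaust)

lemma cscale_nth [simp]: "(c \<cdot>\<^sub>c A) $ i $ k = c * A $ i $ k"
  by (simp add: cscale_def map_matrix_def)

lemma ctranspose_nth [simp]: "ctranspose A $ i $ k = cnj (A $ k $ i)"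
  by (simp add: ctranspose_def map_matrix_def transpose_def)

lemma cscale_mult_left: "(c \<cdot>\<^sub>c A) ** B = c \<cdot>\<^sub>c (A ** B)"
  by (simp add: vec_eq_iff matrix_matrix_mult_def sum_distrib_left mult.assoc)

lemma cscale_mult_right: "A ** (c \<cdot>\<^sub>c B) = c \<cdot>\<^sub>c (A ** B)"
  by (simp add: vec_eq_iff matrix_matrix_mult_def sum_distrib_left ac_simps)

lemma cscale_vector_mult: "(c \<cdot>\<^sub>c A) *v x = c *s (A *v x)"
  by (simp add: vec_eq_iff matrix_vector_mult_def sum_distrib_left mult.assoc)

lemma bounded_linear_cscale: "bounded_linear (cscale c :: complex ^ 'n ^ 'm \<Rightarrow> _)"
  unfolding linear_conv_bounded_linear [symmetric] linear_iff
  by (simp add: vec_eq_iff algebra_simps)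

lemma bounded_linear_ctranspose: "bounded_linear (ctranspose :: complex ^ 'n ^ 'm \<Rightarrow> _)"
  unfolding linear_conv_bounded_linear [symmetric] linear_iff
  by (simp add: vec_eq_iff)

lemmas continuous_on_cscale [continuous_intros] =
  bounded_linear.continuous_on [OF bounded_linear_cscale]

lemmas continuous_on_ctranspose [continuous_intros] =
  bounded_linear.continuous_on [OF bounded_linear_ctranspose]

text \<open>On complex vectors \<open>\<bullet>\<close> is the real part of the Hermitian product,
  so the conjugate transpose is still the adjoint. All forms \<open>y\<^sup>* j y\<close> below are
  expressed by this real inner product.\<close>

lemma inner_ctranspose_left: "(ctranspose A *v x) \<bullet> y = x \<bullet> (A *v y)"
proof -
  have "(ctranspose A *v x) \<bullet> y = (\<Sum>k\<in>UNIV. \<Sum>i\<in>UNIV. (cnj (A $ i $ k) * x $ i) \<bullet> y $ k)"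
    by (simp add: inner_vec_def matrix_vector_mult_def inner_sum_left)
  also have "\<dots> = (\<Sum>i\<in>UNIV. \<Sum>k\<in>UNIV. (cnj (A $ i $ k) * x $ i) \<bullet> y $ k)"
    by (rule sum.swap)
  also have "\<dots> = (\<Sum>i\<in>UNIV. \<Sum>k\<in>UNIV. x $ i \<bullet> (A $ i $ k * y $ k))"
    by (simp add: inner_complex_def algebra_simps)
  also have "\<dots> = x \<bullet> (A *v y)"
    by (simp add: inner_vec_def matrix_vector_mult_def inner_sum_right)
  finally show ?thesis .
qed

lemma ctranspose_ctranspose [simp]: "ctranspose (ctranspose A) = A"
  by (simp add: vec_eq_iff)

lemma norm_matrix_vector_mult_le: "norm (A *v x) \<le> opnorm A * norm x"
  unfolding opnorm_def by (rule onorm [OF matrix_vector_mul_bounded_linear])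

lemma opnorm_nonneg: "0 \<le> opnorm A"
  unfolding opnorm_def by (rule onorm_pos_le [OF matrix_vector_mul_bounded_linear])

text \<open>In the square of \<open>norm ?w\<close> one adjoint is moved back onto \<open>A\<close>;
  then one factor \<open>norm ?w\<close> cancels.\<close>

lemma norm_ctranspose_mult_le: "norm (ctranspose A *v x) \<le> opnorm A * norm x"
proof (cases "ctranspose A *v x = 0")
  case False
  let ?w = "ctranspose A *v x"
  have "norm ?w * norm ?w = x \<bullet> (A *v ?w)"
    using inner_ctranspose_left [of A x ?w] by (simp add: dot_square_norm power2_eq_square)
  also have "\<dots> \<le> norm x * norm (A *v ?w)"
    by (rule norm_cauchy_schwarz)
  also have "\<dots> \<le> norm x * (opnorm A * norm ?w)"
    by (intro mult_left_mono norm_matrix_vector_mult_le) auto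
  finally have "norm ?w * norm ?w \<le> (opnorm A * norm x) * norm ?w"
    by (simp add: ac_simps)
  then show ?thesis
    using False by simp
qed (simp add: opnorm_nonneg)

lemma inner_smult_right:
  fixes x y :: "complex ^ 'n"
  shows "x \<bullet> (c *s y) = Re c * (x \<bullet> y) + Im c * (x \<bullet> (\<i> *s y))"
  by (simp add: inner_vec_def inner_complex_def sum_distrib_left flip: sum.distrib)
    (simp add: algebra_simps)

text \<open>Multiplication by \<open>\<i>\<close> is skew for the real inner product, because
  conjugation changes its sign.\<close>

lemma inner_ii_right:
  fixes x y :: "complex ^ 'n"
  shows "x \<bullet> (\<i> *s y) = - (y \<bullet> (\<i> *s x))"
  by (simp add: inner_vec_def inner_complex_def flip: sum_negf) (simp add: algebra_simps)

lemma norm_smult: "norm (c *s (x :: complex ^ 'n)) = norm c * norm x"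
  by (simp add: norm_vec_def norm_mult L2_set_right_distrib)

lemma inner_smult_self:
  fixes x :: "complex ^ 'n"
  shows "x \<bullet> (c *s x) = Re c * (norm x)\<^sup>2"
  using inner_ii_right [of x x] inner_smult_right [of x c x] by (simp add: dot_square_norm)

text \<open>The form \<open>x\<^sup>* V x\<close> of a selfadjoint matrix is real, so the imaginary
  part of \<open>c\<close> contributes nothing.\<close>

lemma inner_smult_selfadjoint:
  fixes x :: "complex ^ 'n" and V :: "complex ^ 'n ^ 'n"
  assumes V: "\<And>x y. (V *v x) \<bullet> y = x \<bullet> (V *v y)"
  shows "x \<bullet> (c *s (V *v x)) = Re c * (x \<bullet> (V *v x))"
proof -
  have "V *v (\<i> *s x) = \<i> *s (V *v x)"
    by (simp add: vec_eq_iff matrix_vector_mult_def sum_distrib_left ac_simps)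
  then have "x \<bullet> (\<i> *s (V *v x)) = (V *v x) \<bullet> (\<i> *s x)"
    using V [of x "\<i> *s x"] by simp
  with inner_ii_right [of x "V *v x"] inner_smult_right [of x c "V *v x"] show ?thesis
    by simp
qed

section \<open>Block vectors and the action of \<open>j\<close> and \<open>V\<close>\<close>

definition join :: "complex ^ 'm1 \<Rightarrow> complex ^ 'm2 \<Rightarrow> complex ^ ('m1 + 'm2)"
  where "join p q = (\<chi> s. case s of Inl i \<Rightarrow> p $ i | Inr i \<Rightarrow> q $ i)"

lemma join_nth [simp]: "join p q $ Inl i = p $ i" "join p q $ Inr k = q $ k"
  by (simp_all add: join_def)

lemma join_cases: obtains p q where "y = join p q"
proof
  show "y = join (\<chi> i. y $ Inl i) (\<chi> k. y $ Inr k)"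
    by (simp add: vec_eq_iff all_Plus)
qed

lemma inner_join: "join p q \<bullet> join p' q' = p \<bullet> p' + q \<bullet> q'"
  by (simp add: inner_vec_def sum_UNIV_Plus)

lemma norm_join: "(norm (join p q))\<^sup>2 = (norm p)\<^sup>2 + (norm q)\<^sup>2"
  by (simp add: inner_join flip: dot_square_norm)

lemma block_matrix_nth [simp]:
  "block_matrix A B C D $ Inl i $ Inl k = A $ i $ k"
  "block_matrix A B C D $ Inl i $ Inr l = B $ i $ l"
  "block_matrix A B C D $ Inr j $ Inl k = C $ j $ k"
  "block_matrix A B C D $ Inr j $ Inr l = D $ j $ l"
  by (simp_all add: block_matrix_def)

lemma block_matrix_mult:
  "block_matrix A B C D ** block_matrix A' B' C' D' =
    block_matrix (A ** A' + B ** C') (A ** B' + B ** D') (C ** A' + D ** C') (C ** B' + D ** D')"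
  by (simp add: vec_eq_iff all_Plus matrix_matrix_mult_def sum_UNIV_Plus)

lemma block_matrix_vector_mult:
  "block_matrix A B C D *v join p q = join (A *v p + B *v q) (C *v p + D *v q)"
  by (simp add: vec_eq_iff all_Plus matrix_vector_mult_def sum_UNIV_Plus)

text \<open>This is \<open>V\<close> as a function of the value of \<open>v\<close> alone. It is a
  bounded real-linear map, although the conjugate in the lower block prevents complex linearity;
  continuity and derivatives therefore pass from \<open>v\<close> to \<open>V\<close>.\<close>

definition offdiag :: "complex ^ 'm2 ^ 'm1 \<Rightarrow> complex ^ ('m1 + 'm2) ^ ('m1 + 'm2)"
  where "offdiag A = block_matrix 0 A (ctranspose A) 0"

lemma Vmat_eq_offdiag: "Vmat v x t = offdiag (v x t)"
  by (simp add: Vmat_def offdiag_def)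

lemma bounded_linear_offdiag: "bounded_linear (offdiag :: complex ^ 'm2 ^ 'm1 \<Rightarrow> _)"
  unfolding linear_conv_bounded_linear [symmetric] linear_iff
  by (simp add: vec_eq_iff all_Plus offdiag_def)

lemmas continuous_on_offdiag [continuous_intros] =
  bounded_linear.continuous_on [OF bounded_linear_offdiag]

lemma matrix_uminus_mult: "(- A) ** B = - (A ** (B :: complex ^ 'n ^ 'm))" "A ** (- B) = - (A ** B)"
  by (simp_all add: vec_eq_iff matrix_matrix_mult_def sum_negf)

lemma uminus_matrix_vector_mult: "(- A) *v x = - (A *v (x :: complex ^ 'm))"
  by (simp add: vec_eq_iff matrix_vector_mult_def sum_negf)

lemma matrix_zero_mult [simp]: "0 ** (B :: complex ^ 'n ^ 'm) = 0" "(A :: complex ^ 'n ^ 'm) ** 0 = 0"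
  by (simp_all add: vec_eq_iff matrix_matrix_mult_def)

lemma jmat_mult_jmat: "jmat ** jmat = mat 1"
  by (simp add: jmat_def block_matrix_mult matrix_uminus_mult)
    (simp add: vec_eq_iff all_Plus mat_def)

lemma offdiag_mult_jmat: "offdiag A ** jmat = - (jmat ** offdiag A)"
  by (simp add: jmat_def offdiag_def block_matrix_mult matrix_uminus_mult)
    (simp add: vec_eq_iff all_Plus)

lemma jmat_mult_join: "jmat *v join p q = join p (- q)"
  by (simp add: jmat_def block_matrix_vector_mult uminus_matrix_vector_mult)

lemma offdiag_mult_join: "offdiag A *v join p q = join (A *v q) (ctranspose A *v p)"
  by (simp add: offdiag_def block_matrix_vector_mult)

lemma norm_jmat_mult [simp]: "norm (jmat *v y) = norm y"
proof -
  obtain p q where "y = join p q" by (rule join_cases)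
  then have "(norm (jmat *v y))\<^sup>2 = (norm y)\<^sup>2"
    by (simp add: jmat_mult_join norm_join)
  then show ?thesis by simp
qed

lemma inner_jmat_left: "(jmat *v x) \<bullet> y = x \<bullet> (jmat *v y)"
  by (cases x rule: join_cases; cases y rule: join_cases) (simp add: jmat_mult_join inner_join)

lemma inner_offdiag_left: "(offdiag A *v x) \<bullet> y = x \<bullet> (offdiag A *v y)"
proof (cases x rule: join_cases)
  case x: (1 p q)
  show ?thesis
  proof (cases y rule: join_cases)
    case y: (1 p' q')
    have "(A *v q) \<bullet> p' = q \<bullet> (ctranspose A *v p')"
      using inner_ctranspose_left [of "ctranspose A" q p'] by simp
    then show ?thesis
      by (simp add: x y offdiag_mult_join inner_join inner_ctranspose_left)
  qed
qed

lemma norm_offdiag_mult_le: "norm (offdiag A *v y) \<le> opnorm A * norm y"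
proof (cases y rule: join_cases)
  case (1 p q)
  have "(norm (offdiag A *v y))\<^sup>2 = (norm (A *v q))\<^sup>2 + (norm (ctranspose A *v p))\<^sup>2"
    by (simp add: 1 offdiag_mult_join norm_join)
  also have "\<dots> \<le> (opnorm A * norm q)\<^sup>2 + (opnorm A * norm p)\<^sup>2"
    by (intro add_mono power_mono norm_matrix_vector_mult_le norm_ctranspose_mult_le) auto
  also have "\<dots> = (opnorm A * norm y)\<^sup>2"
    by (simp add: 1 power_mult_distrib norm_join algebra_simps)
  finally show ?thesis
    by (rule power2_le_imp_le) (simp add: opnorm_nonneg)
qed

section \<open>The zero curvature identity\<close>

lemmas matrix_mult_diff = bounded_bilinear.diff_left [OF bounded_bilinear_matrix_matrix_mult]
  bounded_bilinear.diff_right [OF bounded_bilinear_matrix_matrix_mult]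

lemmas matrix_mult_add = bounded_bilinear.add_left [OF bounded_bilinear_matrix_matrix_mult]
  bounded_bilinear.add_right [OF bounded_bilinear_matrix_matrix_mult]

text \<open>\<open>V'\<close>, \<open>W\<close> and \<open>W'\<close> stand for \<open>V_x\<close>,
  \<open>V_t\<close> and \<open>V_xx\<close>. Since \<open>J\<close> squares to the identity and
  anticommutes with \<open>V\<close> and \<open>V'\<close>, every product can be brought to a form
  with \<open>J\<close> on the left. The coefficients of the positive powers of \<open>z\<close>
  then agree identically, and the remaining condition at power zero is exactly
  \<open>nls\<close>.\<close>

lemma zero_curvature_matrix:
  fixes J V V' W W' :: "complex ^ 'n ^ 'n"
  assumes J: "J ** J = mat 1" and VJ: "V ** J = - (J ** V)" and V'J: "V' ** J = - (J ** V')"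
    and nls: "J ** W = - ((\<i> / 2) \<cdot>\<^sub>c W') - \<i> \<cdot>\<^sub>c (V ** (V ** V))"
  shows "J ** W
        + ((\<i> * z) \<cdot>\<^sub>c J + J ** V)
          ** (\<i> \<cdot>\<^sub>c (z\<^sup>2 \<cdot>\<^sub>c J - (\<i> * z) \<cdot>\<^sub>c (J ** V) - (1 / 2) \<cdot>\<^sub>c (V' + J ** (V ** V))))
      = \<i> \<cdot>\<^sub>c (- ((\<i> * z) \<cdot>\<^sub>c (J ** V')) - (1 / 2) \<cdot>\<^sub>c (W' + J ** (V ** V' + V' ** V)))
        + (\<i> \<cdot>\<^sub>c (z\<^sup>2 \<cdot>\<^sub>c J - (\<i> * z) \<cdot>\<^sub>c (J ** V) - (1 / 2) \<cdot>\<^sub>c (V' + J ** (V ** V))))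
          ** ((\<i> * z) \<cdot>\<^sub>c J + J ** V)"
proof -
  have JJ: "J ** (J ** A) = A" and VJ': "V ** (J ** A) = - (J ** (V ** A))"
    and V'J': "V' ** (J ** A) = - (J ** (V' ** A))" for A
    by (simp_all add: matrix_mul_assoc J VJ V'J matrix_uminus_mult)
  show ?thesis
    unfolding nls
    by (simp add: matrix_mult_add matrix_mult_diff matrix_uminus_mult
        cscale_mult_left cscale_mult_right matrix_mul_assoc [symmetric] J JJ VJ V'J VJ' V'J')
      (simp add: vec_eq_iff algebra_simps power2_eq_square)
qed

lemma ctranspose_mult: "ctranspose (A ** B) = ctranspose B ** ctranspose A"
  by (simp add: vec_eq_iff matrix_matrix_mult_def mult.commute)

lemma nls_second_derivative:
  assumes "focusing_nls v" "x \<ge> 0" "t \<ge> 0"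
  shows "partial_x (partial_x v) x t =
    (2 * \<i>) \<cdot>\<^sub>c partial_t v x t - 2 \<cdot>\<^sub>c (v x t ** ctranspose (v x t) ** v x t)"
proof -
  have "\<i> \<cdot>\<^sub>c (2 \<cdot>\<^sub>c partial_t v x t
      + \<i> \<cdot>\<^sub>c (partial_x (partial_x v) x t + 2 \<cdot>\<^sub>c (v x t ** ctranspose (v x t) ** v x t))) = 0"
    using assms by (simp add: focusing_nls_def) (simp add: vec_eq_iff)
  then show ?thesis
    by (simp add: vec_eq_iff algebra_simps)
qed

lemma offdiag_cube: "offdiag A ** (offdiag A ** offdiag A) = offdiag (A ** ctranspose A ** A)"
  by (simp add: offdiag_def block_matrix_mult ctranspose_mult matrix_mul_assoc)

text \<open>The lower block of \<open>offdiag\<close> is conjugate linear and receives the factor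
  \<open>- \<i>\<close>; the sign in \<open>j\<close> repairs this.\<close>

lemma jmat_mult_offdiag_cscale: "jmat ** offdiag (\<i> \<cdot>\<^sub>c A) = \<i> \<cdot>\<^sub>c offdiag A"
  by (simp add: jmat_def offdiag_def block_matrix_mult matrix_uminus_mult)
    (simp add: vec_eq_iff all_Plus)

text \<open>This is the Schroedinger equation for \<open>v\<close> in the shape of the hypothesis
  \<open>nls\<close> of \<open>zero_curvature_matrix\<close>.\<close>

lemma nls_offdiag:
  assumes "focusing_nls v" "x \<ge> 0" "t \<ge> 0"
  shows "jmat ** offdiag (partial_t v x t) = - ((\<i> / 2) \<cdot>\<^sub>c offdiag (partial_x (partial_x v) x t))
    - \<i> \<cdot>\<^sub>c (offdiag (v x t) ** (offdiag (v x t) ** offdiag (v x t)))"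
proof -
  let ?vt = "partial_t v x t" and ?vxx = "partial_x (partial_x v) x t"
    and ?c = "v x t ** ctranspose (v x t) ** v x t"
  have "?vt = \<i> \<cdot>\<^sub>c (- ((1 / 2) \<cdot>\<^sub>c ?vxx) - ?c)"
    unfolding nls_second_derivative [OF assms]
    by (simp add: vec_eq_iff algebra_simps)
  then have "jmat ** offdiag ?vt = \<i> \<cdot>\<^sub>c offdiag (- ((1 / 2) \<cdot>\<^sub>c ?vxx) - ?c)"
    by (simp add: jmat_mult_offdiag_cscale)
  also have "offdiag (- ((1 / 2) \<cdot>\<^sub>c ?vxx) - ?c) = - ((1 / 2) \<cdot>\<^sub>c offdiag ?vxx) - offdiag ?c"
    by (simp add: vec_eq_iff all_Plus offdiag_def)
  finally show ?thesis
    by (simp add: offdiag_cube vec_eq_iff algebra_simps)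
qed

section \<open>Dissipation of the form and growth of the norm\<close>

lemma smult_matrix_vector_mult: "A *v (c *s x) = c *s (A *v (x :: complex ^ 'n))"
  by (simp add: vec_eq_iff matrix_vector_mult_def sum_distrib_left ac_simps)

lemma jmat_mult_jmat_vector: "jmat *v (jmat *v y) = y"
  by (cases y rule: join_cases) (simp add: jmat_mult_join)

text \<open>The left side is half the derivative of \<open>y\<^sup>* j y\<close> along the Dirac
  system. Multiplication by \<open>j\<close> leaves \<open>\<i> * z\<close> plus \<open>V\<close>:
  the scalar contributes \<open>- Im z\<close>, the selfadjoint part at most
  \<open>M\<close>.\<close>

lemma dirac_dissipative:
  fixes A :: "complex ^ 'm2 ^ 'm1"
  assumes "opnorm A \<le> M"
  shows "y \<bullet> (jmat *v (((\<i> * z) \<cdot>\<^sub>c jmat + jmat ** offdiag A) *v y)) \<le> (M - Im z) * (norm y)\<^sup>2"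
proof -
  have "y \<bullet> (jmat *v (((\<i> * z) \<cdot>\<^sub>c jmat + jmat ** offdiag A) *v y))
      = y \<bullet> ((\<i> * z) *s y) + y \<bullet> (offdiag A *v y)"
    by (simp add: matrix_vector_mult_add_rdistrib matrix_vector_right_distrib cscale_vector_mult
        smult_matrix_vector_mult jmat_mult_jmat_vector inner_add_right
        flip: matrix_vector_mul_assoc)
  also have "y \<bullet> ((\<i> * z) *s y) = - Im z * (norm y)\<^sup>2"
    by (subst inner_smult_self) simp
  also have "y \<bullet> (offdiag A *v y) \<le> norm y * (opnorm A * norm y)"
    by (rule order_trans [OF norm_cauchy_schwarz mult_left_mono [OF norm_offdiag_mult_le]]) simp
  also have "norm y * (opnorm A * norm y) \<le> norm y * (M * norm y)"
    using assms by (intro mult_left_mono mult_right_mono) auto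
  finally show ?thesis
    by (simp add: algebra_simps power2_eq_square)
qed

lemma norm_offdiag_square_le:
  fixes A B :: "complex ^ 'm2 ^ 'm1"
  assumes "opnorm A \<le> M" "opnorm B \<le> C"
  shows "norm ((offdiag B + jmat ** (offdiag A ** offdiag A)) *v y) \<le> (C + M\<^sup>2) * norm y"
proof -
  have M: "norm (offdiag A *v y) \<le> M * norm y" for y :: "complex ^ ('m1 + 'm2)"
    using norm_offdiag_mult_le [of A y] mult_right_mono [OF assms(1), of "norm y"] by simp
  have "0 \<le> M" using opnorm_nonneg [of A] assms by linarith
  have "norm (jmat *v (offdiag A *v (offdiag A *v y))) \<le> M * (M * norm y)"
    unfolding norm_jmat_mult
    using \<open>0 \<le> M\<close> by (intro order_trans [OF M mult_left_mono [OF M]])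
  moreover have "norm (offdiag B *v y) \<le> C * norm y"
    using norm_offdiag_mult_le [of B y] mult_right_mono [OF assms(2), of "norm y"] by simp
  ultimately show ?thesis
    by (simp add: matrix_vector_mult_add_rdistrib algebra_simps power2_eq_square
        norm_triangle_le flip: matrix_vector_mul_assoc)
qed

lemma Fmat_vector_mult:
  "(\<i> \<cdot>\<^sub>c (z\<^sup>2 \<cdot>\<^sub>c J - (\<i> * z) \<cdot>\<^sub>c (J ** V) - (1 / 2) \<cdot>\<^sub>c W)) *v y
    = (\<i> * z\<^sup>2) *s (J *v y) + z *s (J *v (V *v y)) - (\<i> / 2) *s (W *v y)"
  by (simp add: matrix_vector_mult_diff_rdistrib cscale_vector_mult flip: matrix_vector_mul_assoc)

text \<open>The left side is half the time derivative of \<open>y\<^sup>* j y\<close>. After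
  multiplication by \<open>j\<close>, the term in \<open>z\<^sup>2\<close> becomes the scalar
  \<open>\<i> * z\<^sup>2\<close> with real part \<open>- 2 * Re z * Im z\<close>, which dominates
  once both parts of \<open>z\<close> are large. The term \<open>z V\<close> enters only through
  \<open>Re z\<close>, as \<open>V\<close> is selfadjoint, and the rest is estimated by its
  norm.\<close>

lemma Fmat_dissipative:
  fixes A B :: "complex ^ 'm2 ^ 'm1"
  assumes A: "opnorm A \<le> M" and B: "opnorm B \<le> C" and z: "Re z \<ge> 0"
  shows "y \<bullet> (jmat *v ((\<i> \<cdot>\<^sub>c (z\<^sup>2 \<cdot>\<^sub>c jmat - (\<i> * z) \<cdot>\<^sub>c (jmat ** offdiag A)
        - (1 / 2) \<cdot>\<^sub>c (offdiag B + jmat ** (offdiag A ** offdiag A)))) *v y))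
      \<le> (Re z * M + (C + M\<^sup>2) / 2 - 2 * Re z * Im z) * (norm y)\<^sup>2"
proof -
  let ?W = "offdiag B + jmat ** (offdiag A ** offdiag A)"
  have "y \<bullet> (jmat *v ((\<i> \<cdot>\<^sub>c (z\<^sup>2 \<cdot>\<^sub>c jmat - (\<i> * z) \<cdot>\<^sub>c (jmat ** offdiag A) - (1 / 2) \<cdot>\<^sub>c ?W)) *v y))
      = y \<bullet> ((\<i> * z\<^sup>2) *s y) + y \<bullet> (z *s (offdiag A *v y)) + y \<bullet> ((- (\<i> / 2)) *s (jmat *v (?W *v y)))"
  proof -
    have "jmat *v ((\<i> \<cdot>\<^sub>c (z\<^sup>2 \<cdot>\<^sub>c jmat - (\<i> * z) \<cdot>\<^sub>c (jmat ** offdiag A) - (1 / 2) \<cdot>\<^sub>c W)) *v y)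
      = (\<i> * z\<^sup>2) *s y + z *s (offdiag A *v y) + (- (\<i> / 2)) *s (jmat *v (W *v y))" for W
      by (simp add: Fmat_vector_mult matrix_vector_mult_diff_distrib matrix_vector_right_distrib
          smult_matrix_vector_mult jmat_mult_jmat_vector)
    then show ?thesis
      by (simp add: inner_add_right inner_diff_right)
  qed
  also have "y \<bullet> ((\<i> * z\<^sup>2) *s y) = - (2 * Re z * Im z) * (norm y)\<^sup>2"
    by (subst inner_smult_self) (simp add: power2_eq_square)
  also have "y \<bullet> (z *s (offdiag A *v y)) = Re z * (y \<bullet> (offdiag A *v y))"
    by (rule inner_smult_selfadjoint [OF inner_offdiag_left])
  also have "Re z * (y \<bullet> (offdiag A *v y)) \<le> Re z * (norm y * (opnorm A * norm y))"
    using z by (intro mult_left_mono order_trans [OF norm_cauchy_schwarz] norm_offdiag_mult_le) auto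
  also have "Re z * (norm y * (opnorm A * norm y)) \<le> Re z * (norm y * (M * norm y))"
    using A z by (intro mult_left_mono mult_right_mono) auto
  also have "y \<bullet> ((- (\<i> / 2)) *s (jmat *v (?W *v y))) \<le> norm y * ((C + M\<^sup>2) * norm y / 2)"
    by (rule order_trans [OF norm_cauchy_schwarz mult_left_mono])
      (use norm_offdiag_square_le [OF A B, of y] in \<open>simp_all add: norm_smult norm_divide\<close>)
  finally show ?thesis
    by (simp add: algebra_simps power2_eq_square)
qed

lemma Fmat_growth:
  fixes A B :: "complex ^ 'm2 ^ 'm1"
  assumes A: "opnorm A \<le> M" and B: "opnorm B \<le> C"
  shows "norm ((\<i> \<cdot>\<^sub>c (z\<^sup>2 \<cdot>\<^sub>c jmat - (\<i> * z) \<cdot>\<^sub>c (jmat ** offdiag A)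
        - (1 / 2) \<cdot>\<^sub>c (offdiag B + jmat ** (offdiag A ** offdiag A)))) *v y)
      \<le> ((norm z)\<^sup>2 + norm z * M + (C + M\<^sup>2) / 2) * norm y"
proof -
  let ?W = "offdiag B + jmat ** (offdiag A ** offdiag A)"
  have "norm ((\<i> \<cdot>\<^sub>c (z\<^sup>2 \<cdot>\<^sub>c jmat - (\<i> * z) \<cdot>\<^sub>c (jmat ** offdiag A) - (1 / 2) \<cdot>\<^sub>c ?W)) *v y)
      \<le> norm ((\<i> * z\<^sup>2) *s (jmat *v y)) + norm (z *s (jmat *v (offdiag A *v y)))
      + norm ((\<i> / 2) *s (?W *v y))"
    unfolding Fmat_vector_mult
    by (intro order_trans [OF norm_triangle_ineq4] add_mono norm_triangle_ineq order_refl)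
  also have "norm ((\<i> * z\<^sup>2) *s (jmat *v y)) = (norm z)\<^sup>2 * norm y"
    by (simp add: norm_smult norm_power norm_mult)
  also have "norm (z *s (jmat *v (offdiag A *v y))) \<le> norm z * (M * norm y)"
    using norm_offdiag_mult_le [of A y] mult_right_mono [OF A, of "norm y"]
    by (simp add: norm_smult mult_left_mono)
  also have "norm ((\<i> / 2) *s (?W *v y)) \<le> (C + M\<^sup>2) / 2 * norm y"
    using norm_offdiag_square_le [OF A B, of y] by (simp add: norm_smult norm_divide)
  finally show ?thesis
    by (simp add: algebra_simps)
qed

section \<open>The auxiliary system in the time variable\<close>

lemma has_vector_derivative_jmat_form:
  assumes "(y has_vector_derivative y') (at t within S)"
  shows "((\<lambda>t. y t \<bullet> (jmat *v y t)) has_vector_derivative 2 * (y t \<bullet> (jmat *v y'))) (at t within S)"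
proof -
  have "((\<lambda>t. jmat *v y t) has_vector_derivative jmat *v y') (at t within S)"
    using bounded_linear.has_vector_derivative [OF matrix_vector_mul_bounded_linear assms] .
  from has_vector_derivative_inner [OF assms this] show ?thesis
    using inner_jmat_left [of y' "y t"] inner_commute [of "y t" "jmat *v y'"] by simp
qed

lemma jmat_form_join: "join p q \<bullet> (jmat *v join p q) = (norm p)\<^sup>2 - (norm q)\<^sup>2"
  by (simp add: jmat_mult_join inner_join dot_square_norm)

lemma abs_jmat_form_le: "\<bar>y \<bullet> (jmat *v y)\<bar> \<le> (norm y)\<^sup>2"
  using Cauchy_Schwarz_ineq2 [of y "jmat *v y"] by (simp add: power2_eq_square)

lemma matrix_mult_join_lower:
  obtains p where "A *v join c d = join p (block21 A *v c + block22 A *v d)"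
proof (rule join_cases [of "A *v join c d"])
  fix p q assume pq: "A *v join c d = join p q"
  have "q = block21 A *v c + block22 A *v d"
    using arg_cong [OF pq, of "\<lambda>y. \<chi> k. y $ Inr k"]
    by (simp add: vec_eq_iff matrix_vector_mult_def sum_UNIV_Plus block21_def block22_def)
  with pq show thesis
    by (intro that [of p]) simp
qed

lemma matrix_vector_mult_axis: "(A *v axis k 1) $ i = (A :: complex ^ 'n ^ 'm) $ i $ k"
  by (simp add: matrix_vector_mult_def axis_def if_distrib [of "\<lambda>x. _ * x"] cong: if_cong)

text \<open>Solutions starting at \<open>join 0 q\<close> with \<open>q\<close> nonzero enter ever
  deeper into the negative cone of \<open>j\<close> and grow exponentially, while solutions that
  stay in the nonnegative cone are bounded. By \<open>cone\<close> the graph of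
  \<open>\<Phi>\<close> consists of initial values of the second kind, and comparing the lower
  blocks of both kinds identifies \<open>\<Phi>\<close> as the limit.\<close>

lemma dichotomy_limit:
  fixes F R :: "real \<Rightarrow> complex ^ ('m1::finite + 'm2::finite) ^ ('m1 + 'm2)" and \<Phi> :: "complex ^ 'm1 ^ 'm2"
  assumes R0: "R 0 = mat 1"
    and R: "\<And>t. t \<ge> 0 \<Longrightarrow> (R has_vector_derivative F t ** R t) (at t within {0..})"
    and dissipative: "\<And>t y. t \<ge> 0 \<Longrightarrow> y \<bullet> (jmat *v (F t *v y)) \<le> - (1 / 2) * (norm y)\<^sup>2"
    and growth: "\<And>t y. t \<ge> 0 \<Longrightarrow> norm (F t *v y) \<le> K * norm y" and K: "K \<ge> 0"
    and cone: "\<And>t c. t \<ge> 0 \<Longrightarrow>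
      0 \<le> (R t *v join c (\<Phi> *v c)) \<bullet> (jmat *v (R t *v join c (\<Phi> *v c)))"
  shows "\<And>t. t \<ge> 0 \<Longrightarrow> invertible (block22 (R t))"
    and "((\<lambda>t. - (matrix_inv (block22 (R t)) ** block21 (R t))) \<longlongrightarrow> \<Phi>) at_top"
proof -
  define h where "h y = y \<bullet> (jmat *v y)" for y :: "complex ^ ('m1 + 'm2)"
  have sol: "((\<lambda>t. R t *v a) has_vector_derivative F t *v (R t *v a)) (at t within {0..T})"
    if "t \<in> {0..T}" for t T a
    using that by (intro has_vector_derivative_matrix_solution
        has_vector_derivative_within_subset [OF R]) auto
  note h_deriv = has_vector_derivative_jmat_form [OF sol, folded h_def]
  have lower: "exp t * (norm q)\<^sup>2 \<le> (norm (block22 (R t) *v q))\<^sup>2" if t: "t \<ge> 0" for t q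
  proof -
    \<comment> \<open>Twice the dissipation bound makes the derivative of \<open>h\<close> at most
      \<open>- (norm y)\<^sup>2\<close>, which is at most \<open>h y\<close>; hence the rate 1. The
      initial value of \<open>h\<close> is \<open>- (norm q)\<^sup>2\<close>.\<close>
    have "h (R t *v join 0 q) \<le> exp (1 * (t - 0)) * h (R 0 *v join 0 q)"
    proof (rule exponential_bound [OF t h_deriv])
      fix s assume "s \<in> {0..t}"
      then show "2 * ((R s *v join 0 q) \<bullet> (jmat *v (F s *v (R s *v join 0 q)))) \<le> 1 * h (R s *v join 0 q)"
        using dissipative [of s "R s *v join 0 q"] abs_jmat_form_le [of "R s *v join 0 q"]
        by (simp add: h_def)
    qed
    then have le: "h (R t *v join 0 q) \<le> - (exp t * (norm q)\<^sup>2)"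
      by (simp add: R0 h_def jmat_form_join)
    obtain p where "R t *v join 0 q = join p (block21 (R t) *v 0 + block22 (R t) *v q)"
      by (rule matrix_mult_join_lower)
    then have "h (R t *v join 0 q) = (norm p)\<^sup>2 - (norm (block22 (R t) *v q))\<^sup>2"
      by (simp add: h_def jmat_form_join)
    with le show ?thesis
      using zero_le_power2 [of "norm p"] by linarith
  qed
  show inv: "invertible (block22 (R t))" if "t \<ge> 0" for t
  proof -
    have "q = 0" if "block22 (R t) *v q = 0" for q
      using lower [OF \<open>t \<ge> 0\<close>, of q] that by (simp add: mult_le_0_iff)
    then show ?thesis
      using matrix_left_invertible_ker [of "block22 (R t)"] by (auto simp: invertible_left_inverse)
  qed
  \<comment> \<open>\<open>X t\<close> is the error of the approximation, chosen so that
    \<open>block22 (R t)\<close> maps \<open>X t *v c\<close> to the lower block of the bounded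
    solution \<open>w\<close>. The expansion in \<open>lower\<close> then makes
    \<open>X t *v c\<close> decay.\<close>
  define X where "X t = \<Phi> + matrix_inv (block22 (R t)) ** block21 (R t)" for t
  have X_lim: "((\<lambda>t. X t *v c) \<longlongrightarrow> 0) at_top" for c
  proof -
    define w where "w t = R t *v join c (\<Phi> *v c)" for t
    \<comment> \<open>\<open>2 K\<close> times the decrease of \<open>h\<close> compensates the growth of \<open>w \<bullet> w\<close>, and \<open>h (w t)\<close> is
      nonnegative, so \<open>w\<close> is bounded.\<close>
    define B where "B = w 0 \<bullet> w 0 + 2 * K * h (w 0)"
    have w: "(norm (w t))\<^sup>2 \<le> B" if t: "t \<ge> 0" for t
    proof -
      have "w t \<bullet> w t + 2 * K * h (w t) \<le> B"
        unfolding B_def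
      proof (rule has_vector_derivative_nonpos_imp_le [OF t, where f = "\<lambda>t. w t \<bullet> w t + 2 * K * h (w t)"
            and f' = "\<lambda>s. (w s \<bullet> (F s *v w s) + (F s *v w s) \<bullet> w s)
              + 2 * K * (2 * (w s \<bullet> (jmat *v (F s *v w s))))"])
        fix s assume s: "s \<in> {0..t}"
        have d: "(w has_vector_derivative F s *v w s) (at s within {0..t})"
          unfolding w_def by (rule sol [OF s])
        have "((\<lambda>t. h (w t)) has_vector_derivative 2 * (w s \<bullet> (jmat *v (F s *v w s)))) (at s within {0..t})"
          unfolding h_def by (rule has_vector_derivative_jmat_form [OF d])
        have "((\<lambda>t. 2 * K * h (w t)) has_vector_derivative
            2 * K * (2 * (w s \<bullet> (jmat *v (F s *v w s))))) (at s within {0..t})"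
          by (rule has_vector_derivative_mult_right) fact
        moreover have "((\<lambda>t. w t \<bullet> w t) has_vector_derivative
            (w s \<bullet> (F s *v w s) + (F s *v w s) \<bullet> w s)) (at s within {0..t})"
          by (rule has_vector_derivative_inner [OF d d])
        ultimately show "((\<lambda>t. w t \<bullet> w t + 2 * K * h (w t)) has_vector_derivative
            ((w s \<bullet> (F s *v w s) + (F s *v w s) \<bullet> w s) + 2 * K * (2 * (w s \<bullet> (jmat *v (F s *v w s))))))
            (at s within {0..t})"
          by (rule has_vector_derivative_add [rotated])
        have "w s \<bullet> (F s *v w s) \<le> norm (w s) * (K * norm (w s))"
          using s by (intro order_trans [OF norm_cauchy_schwarz] mult_left_mono growth) auto
        moreover have "2 * K * (w s \<bullet> (jmat *v (F s *v w s))) \<le> 2 * K * (- (1 / 2) * (norm (w s))\<^sup>2)"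
          using s K by (intro mult_left_mono dissipative) auto
        ultimately show "(w s \<bullet> (F s *v w s) + (F s *v w s) \<bullet> w s)
            + 2 * K * (2 * (w s \<bullet> (jmat *v (F s *v w s)))) \<le> 0"
          by (simp add: inner_commute power2_eq_square algebra_simps)
      qed
      moreover have "0 \<le> 2 * K * h (w t)"
        using cone [OF t] K by (simp add: h_def w_def)
      ultimately show ?thesis
        by (simp add: dot_square_norm)
    qed
    have bound: "norm (X t *v c) \<le> sqrt (B * exp (- t))" if t: "t \<ge> 0" for t
    proof -
      have inv_t: "block22 (R t) ** matrix_inv (block22 (R t)) = mat 1"
        using inv [OF t] unfolding invertible_def matrix_inv_def by (rule someI2_ex) simp
      have "block22 (R t) *v (X t *v c) = block21 (R t) *v c + block22 (R t) *v (\<Phi> *v c)"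
        by (simp add: X_def matrix_vector_mult_add_rdistrib matrix_vector_right_distrib
            matrix_vector_mul_assoc matrix_mul_assoc inv_t)
      moreover obtain p where "w t = join p (block21 (R t) *v c + block22 (R t) *v (\<Phi> *v c))"
        unfolding w_def by (rule matrix_mult_join_lower)
      ultimately have "(norm (block22 (R t) *v (X t *v c)))\<^sup>2 \<le> (norm (w t))\<^sup>2"
        by (simp add: norm_join)
      with lower [OF t, of "X t *v c"] w [OF t] have "exp t * (norm (X t *v c))\<^sup>2 \<le> B"
        by linarith
      then have "(norm (X t *v c))\<^sup>2 \<le> B * exp (- t)"
        by (simp add: exp_minus field_simps)
      then show ?thesis
        by (rule real_le_rsqrt)
    qed
    have "((\<lambda>t. exp (- t)) \<longlongrightarrow> (0 :: real)) at_top"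
      by (rule filterlim_compose [OF exp_at_bot filterlim_uminus_at_bot_at_top])
    then have "((\<lambda>t. sqrt (B * exp (- t))) \<longlongrightarrow> sqrt (B * 0)) at_top"
      by (rule tendsto_real_sqrt [OF tendsto_mult_left])
    then have "((\<lambda>t. sqrt (B * exp (- t))) \<longlongrightarrow> 0) at_top"
      by simp
    then show ?thesis
      by (rule Lim_null_comparison [rotated])
        (use bound in \<open>auto simp: eventually_at_top_linorder\<close>)
  qed
  have "(X \<longlongrightarrow> 0) at_top"
  proof (intro vec_tendstoI)
    fix i k
    have "((\<lambda>t. (X t *v axis k 1) $ i) \<longlongrightarrow> 0 $ i) at_top"
      by (intro tendsto_vec_nth X_lim)
    then show "((\<lambda>t. X t $ i $ k) \<longlongrightarrow> 0 $ i $ k) at_top"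
      by (simp add: matrix_vector_mult_axis)
  qed
  then have "((\<lambda>t. \<Phi> - X t) \<longlongrightarrow> \<Phi> - 0) at_top"
    by (rule tendsto_diff [OF tendsto_const])
  then show "((\<lambda>t. - (matrix_inv (block22 (R t)) ** block21 (R t))) \<longlongrightarrow> \<Phi>) at_top"
    by (simp add: X_def)
qed

section \<open>Solutions of the nonlinear Schroedinger equation\<close>

lemma has_vector_derivative_partial_x:
  assumes "has_partial_x f" "x \<ge> 0" "t \<ge> 0"
  shows "((\<lambda>s. f s t) has_vector_derivative partial_x f x t) (at x within {0..})"
  using assms by (simp add: has_partial_x_def partial_x_def vector_derivative_works)

lemma has_vector_derivative_partial_t:
  assumes "has_partial_t f" "x \<ge> 0" "t \<ge> 0"
  shows "((\<lambda>s. f x s) has_vector_derivative partial_t f x t) (at t within {0..})"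
  using assms by (simp add: has_partial_t_def partial_t_def vector_derivative_works)

text \<open>The definition requires continuity of the partial derivatives only. Joint continuity of
  \<open>f\<close> follows by integrating \<open>partial_x f\<close> from the edge
  \<open>x = 0\<close>, where \<open>f\<close> is continuous in \<open>t\<close>.\<close>

lemma continuously_differentiable_imp_continuous_on:
  fixes f :: "real \<Rightarrow> real \<Rightarrow> 'a :: banach"
  assumes f: "continuously_differentiable f"
  shows "continuous_on ({0..X} \<times> {0..T}) (\<lambda>(x, t). f x t)"
proof -
  have f_x: "has_partial_x f" and f_t: "has_partial_t f"
    and cont: "continuous_on ({0..} \<times> {0..}) (\<lambda>(x, t). partial_x f x t)"
    using f by (auto simp: continuously_differentiable_def)
  have "continuous_on {0..} (\<lambda>t. f 0 t)"
    by (rule continuous_on_vector_derivative)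
      (use has_vector_derivative_partial_t [OF f_t] in auto)
  then have "continuous_on ({0..X} \<times> {0..T}) (\<lambda>p. f 0 (snd p))"
    by (rule continuous_on_compose2) (auto intro!: continuous_intros)
  moreover have "continuous_on ({0..X} \<times> {0..T}) (\<lambda>(x, t). integral {0..x} (\<lambda>s. partial_x f s t))"
    by (intro integral_indefinite_continuous_on_param continuous_on_subset [OF cont]) auto
  ultimately have sum: "continuous_on ({0..X} \<times> {0..T})
      (\<lambda>p. f 0 (snd p) + integral {0..fst p} (\<lambda>s. partial_x f s (snd p)))"
    unfolding case_prod_unfold by (rule continuous_on_add)
  have eq: "f 0 t + integral {0..x} (\<lambda>s. partial_x f s t) = f x t"
    if "x \<in> {0..X}" "t \<in> {0..T}" for x t
  proof -
    have "((\<lambda>s. partial_x f s t) has_integral (f x t - f 0 t)) {0..x}"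
      using that by (intro fundamental_theorem_of_calculus
          has_vector_derivative_within_subset [OF has_vector_derivative_partial_x [OF f_x]]) auto
    then show ?thesis
      by (simp add: integral_unique)
  qed
  show ?thesis
    using sum by (rule continuous_on_eq) (auto simp: eq)
qed

lemma partial_x_Vmat:
  assumes "has_partial_x v" "x \<ge> 0" "t \<ge> 0"
  shows "partial_x (Vmat v) x t = offdiag (partial_x v x t)"
proof -
  \<comment> \<open>A connected set with more than one point has no isolated points, so derivatives
    within the half-line are unique, including the one-sided one at 0.\<close>
  have "{0 :: real..} \<noteq> {a}" for a
    using infinite_Ici [of "0 :: real"] by (metis finite.emptyI finite.insertI)
  then have "at x within {0..} \<noteq> bot"
    using connected_imp_perfect [of "{0 :: real..}" x] assms by (auto simp: trivial_limit_within)
  moreover have "((\<lambda>s. Vmat v s t) has_vector_derivative offdiag (partial_x v x t)) (at x within {0..})"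
    unfolding Vmat_eq_offdiag
    by (rule bounded_linear.has_vector_derivative
        [OF bounded_linear_offdiag has_vector_derivative_partial_x [OF assms]])
  ultimately show ?thesis
    unfolding partial_x_def by (rule vector_derivative_within)
qed

lemma Fmat_eq:
  assumes "has_partial_x v" "x \<ge> 0" "t \<ge> 0"
  shows "Fmat v x t z = \<i> \<cdot>\<^sub>c (z\<^sup>2 \<cdot>\<^sub>c jmat - (\<i> * z) \<cdot>\<^sub>c (jmat ** offdiag (v x t))
    - (1 / 2) \<cdot>\<^sub>c (offdiag (partial_x v x t) + jmat ** (offdiag (v x t) ** offdiag (v x t))))"
  by (simp add: Fmat_def Vmat_eq_offdiag partial_x_Vmat [OF assms])

text \<open>For \<open>v_xx\<close> mere existence is assumed; the equation expresses it through
  \<open>v\<close> and \<open>v_t\<close>, which gives its continuity.\<close>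

lemma nls_continuous_on:
  fixes v :: "real \<Rightarrow> real \<Rightarrow> complex ^ 'm2 ^ 'm1"
  assumes C1: "continuously_differentiable v" and nls: "focusing_nls v"
  shows "continuous_on ({0..X} \<times> {0..T}) (\<lambda>p. v (fst p) (snd p))" (is ?v)
    and "continuous_on ({0..X} \<times> {0..T}) (\<lambda>p. partial_x v (fst p) (snd p))"
    and "continuous_on ({0..X} \<times> {0..T}) (\<lambda>p. partial_t v (fst p) (snd p))" (is ?vt)
    and "continuous_on ({0..X} \<times> {0..T}) (\<lambda>p. partial_x (partial_x v) (fst p) (snd p))"
proof -
  show ?v
    using continuously_differentiable_imp_continuous_on [OF C1] by (simp add: case_prod_unfold)
  show "continuous_on ({0..X} \<times> {0..T}) (\<lambda>p. partial_x v (fst p) (snd p))"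
    by (rule continuous_on_subset [of "{0..} \<times> {0..}"])
      (use C1 in \<open>auto simp: continuously_differentiable_def case_prod_unfold\<close>)
  show ?vt
    by (rule continuous_on_subset [of "{0..} \<times> {0..}"])
      (use C1 in \<open>auto simp: continuously_differentiable_def case_prod_unfold\<close>)
  have "continuous_on ({0..X} \<times> {0..T}) (\<lambda>p. (2 * \<i>) \<cdot>\<^sub>c partial_t v (fst p) (snd p)
      - 2 \<cdot>\<^sub>c (v (fst p) (snd p) ** ctranspose (v (fst p) (snd p)) ** v (fst p) (snd p)))"
    by (intro continuous_intros \<open>?v\<close> \<open>?vt\<close>)
  then show "continuous_on ({0..X} \<times> {0..T}) (\<lambda>p. partial_x (partial_x v) (fst p) (snd p))"
    by (rule continuous_on_eq) (auto simp: nls_second_derivative [OF nls])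
qed

text \<open>The Dirac system is solved in \<open>x\<close> for each \<open>t\<close> with initial
  value \<open>w t\<close> at \<open>x = 0\<close>. Zero curvature then supplies the equation in
  \<open>t\<close>, and uniqueness identifies the solution at \<open>t = 0\<close> with
  \<open>y\<^sub>0\<close>.\<close>

lemma joint_solution:
  fixes v :: "real \<Rightarrow> real \<Rightarrow> complex ^ 'm2 ^ 'm1"
  assumes C1: "continuously_differentiable v" and vxx: "has_partial_x (partial_x v)"
    and nls: "focusing_nls v" and XT: "0 \<le> X" "0 \<le> T"
    and w: "\<And>t. t \<in> {0..T} \<Longrightarrow> (w has_vector_derivative Fmat v 0 t z *v w t) (at t within {0..T})"
    and y\<^sub>0: "\<And>x. x \<in> {0..X} \<Longrightarrow>
      (y\<^sub>0 has_vector_derivative dirac_coeff v x z *v y\<^sub>0 x) (at x within {0..X})"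
    and w0: "y\<^sub>0 0 = w 0"
  obtains y where "\<And>t. t \<in> {0..T} \<Longrightarrow> y 0 t = w t" and "\<And>x. x \<in> {0..X} \<Longrightarrow> y x 0 = y\<^sub>0 x"
    and "\<And>x t. x \<in> {0..X} \<Longrightarrow> t \<in> {0..T} \<Longrightarrow> ((\<lambda>x. y x t) has_vector_derivative
      ((\<i> * z) \<cdot>\<^sub>c jmat + jmat ** offdiag (v x t)) *v y x t) (at x within {0..X})"
    and "\<And>x t. x \<in> {0..X} \<Longrightarrow> t \<in> {0..T} \<Longrightarrow>
      ((\<lambda>t. y x t) has_vector_derivative Fmat v x t z *v y x t) (at t within {0..T})"
proof -
  have v_x: "has_partial_x v" and v_t: "has_partial_t v"
    using C1 by (auto simp: continuously_differentiable_def)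
  define V where "V x t = offdiag (v x t)" for x t
  define V' where "V' x t = offdiag (partial_x v x t)" for x t
  define W where "W x t = offdiag (partial_t v x t)" for x t
  define W' where "W' x t = offdiag (partial_x (partial_x v) x t)" for x t
  define G where "G x t = (\<i> * z) \<cdot>\<^sub>c jmat + jmat ** V x t" for x t
  define F where "F x t = \<i> \<cdot>\<^sub>c (z\<^sup>2 \<cdot>\<^sub>c jmat - (\<i> * z) \<cdot>\<^sub>c (jmat ** V x t)
      - (1 / 2) \<cdot>\<^sub>c (V' x t + jmat ** (V x t ** V x t)))" for x t
  define F' where "F' x t = \<i> \<cdot>\<^sub>c (- ((\<i> * z) \<cdot>\<^sub>c (jmat ** V' x t))
      - (1 / 2) \<cdot>\<^sub>c (W' x t + jmat ** (V x t ** V' x t + V' x t ** V x t)))" for x t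
  note bl = bounded_linear.has_vector_derivative
  note mult = bounded_bilinear_matrix_matrix_mult
  note mult_right = bl [OF bounded_bilinear.bounded_linear_right [OF mult]]
  have F: "F x t = Fmat v x t z" if "x \<in> {0..X}" "t \<in> {0..T}" for x t
    using that by (simp add: Fmat_eq [OF v_x] F_def V_def V'_def)
  have V_t: "((\<lambda>t. V x t) has_vector_derivative W x t) (at t within {0..T})"
    if "x \<in> {0..X}" "t \<in> {0..T}" for x t
    using that unfolding V_def W_def
    by (intro bl [OF bounded_linear_offdiag] has_vector_derivative_within_subset
        [OF has_vector_derivative_partial_t [OF v_t]]) auto
  have V_x: "((\<lambda>x. V x t) has_vector_derivative V' x t) (at x within {0..X})"
    if "x \<in> {0..X}" "t \<in> {0..T}" for x t
    using that unfolding V_def V'_def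
    by (intro bl [OF bounded_linear_offdiag] has_vector_derivative_within_subset
        [OF has_vector_derivative_partial_x [OF v_x]]) auto
  have V'_x: "((\<lambda>x. V' x t) has_vector_derivative W' x t) (at x within {0..X})"
    if "x \<in> {0..X}" "t \<in> {0..T}" for x t
    using that unfolding V'_def W'_def
    by (intro bl [OF bounded_linear_offdiag] has_vector_derivative_within_subset
        [OF has_vector_derivative_partial_x [OF vxx]]) auto
  have G_t: "((\<lambda>t. G x t) has_vector_derivative jmat ** W x t) (at t within {0..T})"
    if "x \<in> {0..X}" "t \<in> {0..T}" for x t
    unfolding G_def
    using has_vector_derivative_add [OF has_vector_derivative_const mult_right [OF V_t [OF that]]]
    by simp
  have F_x: "((\<lambda>x. F x t) has_vector_derivative F' x t) (at x within {0..X})"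
    if "x \<in> {0..X}" "t \<in> {0..T}" for x t
  proof -
    have "((\<lambda>x. z\<^sup>2 \<cdot>\<^sub>c jmat - (\<i> * z) \<cdot>\<^sub>c (jmat ** V x t)) has_vector_derivative
        0 - (\<i> * z) \<cdot>\<^sub>c (jmat ** V' x t)) (at x within {0..X})"
      by (intro has_vector_derivative_diff has_vector_derivative_const
          bl [OF bounded_linear_cscale] mult_right V_x that)
    moreover have "((\<lambda>x. V x t ** V x t) has_vector_derivative (V x t ** V' x t + V' x t ** V x t))
        (at x within {0..X})"
      by (rule bounded_bilinear.has_vector_derivative [OF mult V_x [OF that] V_x [OF that]])
    then have "((\<lambda>x. (1 / 2) \<cdot>\<^sub>c (V' x t + jmat ** (V x t ** V x t))) has_vector_derivative
        (1 / 2) \<cdot>\<^sub>c (W' x t + jmat ** (V x t ** V' x t + V' x t ** V x t))) (at x within {0..X})"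
      by (rule bl [OF bounded_linear_cscale
            has_vector_derivative_add [OF V'_x [OF that] mult_right]])
    ultimately have "((\<lambda>x. F x t) has_vector_derivative
        \<i> \<cdot>\<^sub>c ((0 - (\<i> * z) \<cdot>\<^sub>c (jmat ** V' x t))
          - (1 / 2) \<cdot>\<^sub>c (W' x t + jmat ** (V x t ** V' x t + V' x t ** V x t)))) (at x within {0..X})"
      unfolding F_def by (rule bl [OF bounded_linear_cscale has_vector_derivative_diff])
    then show ?thesis
      by (simp add: F'_def)
  qed
  have curv: "jmat ** W x t + G x t ** F x t = F' x t + F x t ** G x t"
    if "x \<in> {0..X}" "t \<in> {0..T}" for x t
  proof -
    have *: "jmat ** W x t = - ((\<i> / 2) \<cdot>\<^sub>c W' x t) - \<i> \<cdot>\<^sub>c (V x t ** (V x t ** V x t))"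
      using that by (simp add: W_def W'_def V_def nls_offdiag [OF nls])
    show ?thesis
      unfolding G_def F_def F'_def
      by (rule zero_curvature_matrix [OF jmat_mult_jmat _ _ *])
        (simp_all add: V_def V'_def offdiag_mult_jmat)
  qed
  note cont_v = nls_continuous_on [OF C1 nls, where X = X and T = T]
  have G: "continuous_on ({0..X} \<times> {0..T}) (\<lambda>(x, t). G x t)"
    unfolding G_def V_def case_prod_unfold by (intro continuous_intros cont_v)
  obtain y where y: "continuous_on ({0..X} \<times> {0..T}) (\<lambda>(x, t). y x t)"
    and y_w: "\<And>t. t \<in> {0..T} \<Longrightarrow> y 0 t = w t"
    and y_x: "\<And>x t. x \<in> {0..X} \<Longrightarrow> t \<in> {0..T} \<Longrightarrow>
      ((\<lambda>s. y s t) has_vector_derivative G x t *v y x t) (at x within {0..X})"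
    using linear_system_exists [OF XT G continuous_on_vector_derivative [OF w]] by blast
  \<comment> \<open>Both functions solve the same linear system and agree at \<open>x = 0\<close>,
    so the growth bound for their difference has right-hand side 0.\<close>
  have y_y0: "y x 0 = y\<^sub>0 x" if x: "x \<in> {0..X}" for x
  proof -
    have "continuous_on {0..X} (\<lambda>x. G x 0)"
      using continuous_on_prod_slices(1) [OF G, of 0] XT by simp
    then obtain C where C: "\<And>x a. x \<in> {0..X} \<Longrightarrow> norm (G x 0 *v a) \<le> C * norm a"
      using bounded_on_compact_matrix [OF compact_Icc] by blast
    have "(norm (y x 0 - y\<^sub>0 x))\<^sup>2 \<le> exp (2 * C * x) * (norm (y 0 0 - y\<^sub>0 0))\<^sup>2"
    proof (rule linear_system_growth [where A = "\<lambda>x. G x 0"])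
      fix s assume s: "s \<in> {0..x}"
      have "((\<lambda>x. y x 0 - y\<^sub>0 x) has_vector_derivative G s 0 *v y s 0 - G s 0 *v y\<^sub>0 s) (at s within {0..X})"
        using s x XT y\<^sub>0 [of s]
        by (intro has_vector_derivative_diff y_x) (auto simp: dirac_coeff_def G_def Vmat_eq_offdiag V_def)
      then show "((\<lambda>x. y x 0 - y\<^sub>0 x) has_vector_derivative G s 0 *v (y s 0 - y\<^sub>0 s)) (at s within {0..x})"
        unfolding matrix_vector_mult_diff_distrib
        by (rule has_vector_derivative_within_subset) (use x in auto)
      show "norm (G s 0 *v (y s 0 - y\<^sub>0 s)) \<le> C * norm (y s 0 - y\<^sub>0 s)"
        using s x by (intro C) auto
    qed (use x in auto)
    then show ?thesis
      using y_w [of 0] w0 XT by simp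
  qed
  have "((\<lambda>t. y x t) has_vector_derivative F x t *v y x t) (at t within {0..T})"
    if "x \<in> {0..X}" "t \<in> {0..T}" for x t
  proof (rule zero_curvature_flow [where F' = F', OF XT G _ _ _ G_t F_x curv y y_x _ that])
    show "continuous_on ({0..X} \<times> {0..T}) (\<lambda>(x, t). jmat ** W x t)"
      unfolding W_def case_prod_unfold by (intro continuous_intros cont_v)
    show "continuous_on ({0..X} \<times> {0..T}) (\<lambda>(x, t). F x t)"
      unfolding F_def V_def V'_def case_prod_unfold by (intro continuous_intros cont_v)
    show "continuous_on ({0..X} \<times> {0..T}) (\<lambda>(x, t). F' x t)"
      unfolding F'_def V_def V'_def W'_def case_prod_unfold by (intro continuous_intros cont_v)
    show "((\<lambda>t. y 0 t) has_vector_derivative F 0 t *v y 0 t) (at t within {0..T})"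
      if "t \<in> {0..T}" for t
      using w [OF that] XT that
      by (intro has_vector_derivative_transform [OF that y_w]) (auto simp: F y_w)
  qed
  with y_w y_y0 y_x show thesis
    by (intro that [of y]) (auto simp: F G_def V_def)
qed

section \<open>From the Weyl solution to the nonnegative cone\<close>

lemma not_set_integrable_bounded_below:
  fixes f :: "real \<Rightarrow> real"
  assumes "\<delta> > 0" and f: "\<And>x. x \<ge> 0 \<Longrightarrow> \<delta> \<le> f x"
  shows "\<not> set_integrable lborel {0..} f"
proof
  assume "set_integrable lborel {0..} f"
  then have int: "integrable lborel (\<lambda>x. indicator {0..} x *\<^sub>R f x)"
    by (simp add: set_integrable_def)
  have "integrable lborel (\<lambda>x :: real. \<delta> * indicator {0..} x)"
  proof (rule Bochner_Integration.integrable_bound [OF int])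
    show "(\<lambda>x :: real. \<delta> * indicator {0..} x) \<in> borel_measurable lborel"
      by measurable
    show "AE x :: real in lborel. norm (\<delta> * indicator {0..} x) \<le> norm (indicator {0..} x *\<^sub>R f x)"
      using f \<open>\<delta> > 0\<close> by (intro AE_I2) (force simp: indicator_def)
  qed
  then have "integrable lborel (\<lambda>x. inverse \<delta> * (\<delta> * indicator {0 :: real..} x))"
    by (rule integrable_mult_right)
  then have "integrable lborel (indicator {0 :: real..} :: real \<Rightarrow> real)"
    using \<open>\<delta> > 0\<close> by (simp add: mult.assoc [symmetric])
  then have "emeasure lborel {0 :: real..} < \<infinity>"
    by (simp add: integrable_indicator_iff)
  moreover have "emeasure lborel {0 :: real..} \<ge> ennreal (real n)" for n
    using emeasure_mono [of "{0 .. real n}" "{0..}" lborel] by auto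
  ultimately show False
    by (metis ennreal_of_nat_eq_real_of_nat ennreal_Ex_less_of_nat infinity_ennreal_def not_le)
qed

text \<open>A negative value of the form at \<open>(0, T)\<close> only decreases further in
  \<open>x\<close>, which bounds the norm of \<open>y X T\<close> from below for every
  \<open>X\<close>. Going back from time \<open>T\<close> to time 0 costs a fixed factor, so
  \<open>y\<^sub>0\<close> would be bounded away from 0, against \<open>int\<close>. The joint
  solution may depend on \<open>X\<close>, since only its values on the edges of the rectangle are
  compared.\<close>

lemma weyl_solution_cone:
  fixes v :: "real \<Rightarrow> real \<Rightarrow> complex ^ 'm2 ^ 'm1"
  assumes C1: "continuously_differentiable v" and vxx: "has_partial_x (partial_x v)"
    and nls: "focusing_nls v"
    and v_bound: "\<And>x t. x \<ge> 0 \<Longrightarrow> t \<ge> 0 \<Longrightarrow> opnorm (v x t) \<le> M"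
    and vx_bound: "\<And>x t. x \<ge> 0 \<Longrightarrow> t \<in> {0..T} \<Longrightarrow> opnorm (partial_x v x t) \<le> C"
    and z: "Im z > M" and T: "T \<ge> 0"
    and w: "\<And>t. t \<ge> 0 \<Longrightarrow> (w has_vector_derivative Fmat v 0 t z *v w t) (at t within {0..})"
    and y\<^sub>0: "\<And>x. x \<ge> 0 \<Longrightarrow>
      (y\<^sub>0 has_vector_derivative dirac_coeff v x z *v y\<^sub>0 x) (at x within {0..})"
    and w0: "y\<^sub>0 0 = w 0"
    and int: "set_integrable lborel {0..} (\<lambda>x. (norm (y\<^sub>0 x))\<^sup>2)"
  shows "0 \<le> w T \<bullet> (jmat *v w T)"
proof (rule ccontr)
  assume "\<not> 0 \<le> w T \<bullet> (jmat *v w T)"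
  then have neg: "w T \<bullet> (jmat *v w T) < 0" by simp
  \<comment> \<open>\<open>K\<close> bounds the coefficient in \<open>t\<close> on the whole strip
    of times up to \<open>T\<close>. Its independence of \<open>x\<close> makes the lower bound
    below uniform in \<open>X\<close>.\<close>
  define K where "K = (norm z)\<^sup>2 + norm z * M + (C + M\<^sup>2) / 2"
  have "- (w T \<bullet> (jmat *v w T)) * exp (- (2 * K * T)) \<le> (norm (y\<^sub>0 X))\<^sup>2" if X: "X \<ge> 0" for X
  proof -
    have w': "(w has_vector_derivative Fmat v 0 t z *v w t) (at t within {0..T})" if "t \<in> {0..T}" for t
      using that by (intro has_vector_derivative_within_subset [OF w]) auto
    have y\<^sub>0': "(y\<^sub>0 has_vector_derivative dirac_coeff v x z *v y\<^sub>0 x) (at x within {0..X})"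
      if "x \<in> {0..X}" for x
      using that by (intro has_vector_derivative_within_subset [OF y\<^sub>0]) auto
    obtain y where y_w: "\<And>t. t \<in> {0..T} \<Longrightarrow> y 0 t = w t" and y_y0: "\<And>x. x \<in> {0..X} \<Longrightarrow> y x 0 = y\<^sub>0 x"
      and y_x: "\<And>x t. x \<in> {0..X} \<Longrightarrow> t \<in> {0..T} \<Longrightarrow> ((\<lambda>x. y x t) has_vector_derivative
        ((\<i> * z) \<cdot>\<^sub>c jmat + jmat ** offdiag (v x t)) *v y x t) (at x within {0..X})"
      and y_t: "\<And>x t. x \<in> {0..X} \<Longrightarrow> t \<in> {0..T} \<Longrightarrow>
        ((\<lambda>t. y x t) has_vector_derivative Fmat v x t z *v y x t) (at t within {0..T})"
      using joint_solution [OF C1 vxx nls X T w' y\<^sub>0' w0] by blast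
    have "y X T \<bullet> (jmat *v y X T) \<le> y 0 T \<bullet> (jmat *v y 0 T)"
    proof (rule has_vector_derivative_nonpos_imp_le [OF X])
      fix x assume x: "x \<in> {0..X}"
      show "((\<lambda>x. y x T \<bullet> (jmat *v y x T)) has_vector_derivative
          2 * (y x T \<bullet> (jmat *v (((\<i> * z) \<cdot>\<^sub>c jmat + jmat ** offdiag (v x T)) *v y x T)))) (at x within {0..X})"
        using x T by (intro has_vector_derivative_jmat_form y_x) auto
      have "y x T \<bullet> (jmat *v (((\<i> * z) \<cdot>\<^sub>c jmat + jmat ** offdiag (v x T)) *v y x T))
          \<le> (M - Im z) * (norm (y x T))\<^sup>2"
        using x T by (intro dirac_dissipative v_bound) auto
      also have "\<dots> \<le> 0"
        using z by (intro mult_nonpos_nonneg) auto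
      finally show "2 * (y x T \<bullet> (jmat *v (((\<i> * z) \<cdot>\<^sub>c jmat + jmat ** offdiag (v x T)) *v y x T))) \<le> 0"
        by simp
    qed
    then have "- (w T \<bullet> (jmat *v w T)) \<le> (norm (y X T))\<^sup>2"
      using abs_jmat_form_le [of "y X T"] y_w [of T] T by simp
    also have "(norm (y X T))\<^sup>2 \<le> exp (2 * K * T) * (norm (y X 0))\<^sup>2"
    proof (rule linear_system_growth [OF T y_t])
      fix t assume t: "t \<in> {0..T}"
      have v_x: "has_partial_x v"
        using C1 by (simp add: continuously_differentiable_def)
      show "norm (Fmat v X t z *v y X t) \<le> K * norm (y X t)"
        using X t unfolding K_def
        by (subst Fmat_eq [OF v_x]) (auto intro!: Fmat_growth v_bound vx_bound)
    qed (use X in auto)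
    finally show ?thesis
      using y_y0 [of X] X by (simp add: exp_minus field_simps)
  qed
  then show False
    using not_set_integrable_bounded_below [of "- (w T \<bullet> (jmat *v w T)) * exp (- (2 * K * T))"
        "\<lambda>x. (norm (y\<^sub>0 x))\<^sup>2"] neg int by (simp add: mult_neg_pos)
qed


lemma block_col_vector_mult: "block_col A C *v c = join (A *v c) (C *v c)"
  by (simp add: vec_eq_iff all_Plus block_col_def matrix_vector_mult_def)

text \<open>The map taking a matrix \<open>A\<close> to \<open>c \<bullet> (A *v c)\<close> is
  bounded and linear, so it preserves integrability; on the integrand of the Weyl condition its
  value is the squared norm of the Weyl solution.\<close>

lemma weyl_function_square_integrable:
  assumes "weyl_function u M \<phi>" "Im z > M"
  shows "set_integrable lborel {0..} (\<lambda>x. (norm (u x z *v join c (\<phi> z *v c)))\<^sup>2)"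
proof -
  let ?B = "block_col (mat 1) (\<phi> z)"
  let ?f = "\<lambda>x. ctranspose ?B ** ctranspose (u x z) ** u x z ** ?B"
  have "bounded_linear (\<lambda>A. c \<bullet> (A *v c))"
    by (rule bounded_linear_compose [OF bounded_linear_inner_right
          bounded_bilinear.bounded_linear_left [OF bounded_bilinear_matrix_vector_mult]])
  moreover have "integrable lborel (\<lambda>x. indicator {0..} x *\<^sub>R ?f x)"
    using assms by (simp add: weyl_function_def set_integrable_def)
  ultimately have "integrable lborel (\<lambda>x. c \<bullet> ((indicator {0..} x *\<^sub>R ?f x) *v c))"
    by (rule integrable_bounded_linear)
  moreover have "c \<bullet> (?f x *v c) = (norm (u x z *v join c (\<phi> z *v c)))\<^sup>2" for x
  proof -
    have "c \<bullet> (?f x *v c) = c \<bullet> (ctranspose ?B *v (ctranspose (u x z) *v (u x z *v (?B *v c))))"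
      by (simp add: matrix_vector_mul_assoc matrix_mul_assoc)
    also have "\<dots> = (u x z *v (?B *v c)) \<bullet> (u x z *v (?B *v c))"
      using inner_ctranspose_left [of "ctranspose ?B" c] inner_ctranspose_left [of "ctranspose (u x z)" "?B *v c"]
      by simp
    finally show ?thesis
      by (simp add: block_col_vector_mult dot_square_norm)
  qed
  ultimately show ?thesis
    by (simp add: set_integrable_def bounded_bilinear.scaleR_left [OF bounded_bilinear_matrix_vector_mult])
qed

section \<open>Choice of the domain of \<open>z\<close> and assembly\<close>

theorem theorem5p4:
  fixes v :: "real \<Rightarrow> real \<Rightarrow> complex ^ 'm2 ^ 'm1"
    and M :: real
    and u R :: "real \<Rightarrow> complex \<Rightarrow> complex ^ ('m1 + 'm2) ^ ('m1 + 'm2)"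
    and \<phi> :: "complex \<Rightarrow> complex ^ 'm1 ^ 'm2"
  assumes C1: "continuously_differentiable v"
    and vxx: "has_partial_x (partial_x v)"
    and nls: "focusing_nls v"
    and M_pos: "M > 0"
    and v_bound: "\<forall>x\<ge>0. \<forall>t\<ge>0. opnorm (v x t) \<le> M"
    and vx_bound_0: "bdd_above ((\<lambda>t. opnorm (partial_x v 0 t)) ` {0..})"
    and vx_bound: "\<forall>c>0. bdd_above ((\<lambda>(x, t). opnorm (partial_x v x t)) ` ({0..} \<times> {0..<c}))"
    and u: "normalized_fundamental_solution (dirac_coeff v) u"
    and weyl: "weyl_function u M \<phi>"
    and R: "normalized_fundamental_solution (\<lambda>t z. Fmat v 0 t z) R"
  shows "\<exists>M1 M2. M1 > M \<and> M2 > 0 \<and>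
    (\<forall>z. Im z > M1 \<and> Re z > M2 \<longrightarrow>
      (\<forall>t\<ge>0. invertible (block22 (R t z))) \<and>
      ((\<lambda>t. - (matrix_inv (block22 (R t z)) ** block21 (R t z))) \<longlongrightarrow> \<phi> z) at_top)"
proof -
  have v_x: "has_partial_x v"
    using C1 by (simp add: continuously_differentiable_def)
  obtain C where C: "\<And>t. t \<ge> 0 \<Longrightarrow> opnorm (partial_x v 0 t) \<le> C"
    using vx_bound_0 by (auto simp: bdd_above_def)
  have "C \<ge> 0"
    using C [of 0] opnorm_nonneg [of "partial_x v 0 0"] by simp
  \<comment> \<open>For \<open>Im z\<close> above \<open>M\<close>, the rate in
    \<open>Fmat_dissipative\<close> is at most \<open>(C + M\<^sup>2) / 2 - Re z * M\<close>. The
    condition \<open>Re z > M2\<close> makes this at most -1/2, the rate required by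
    \<open>dichotomy_limit\<close>.\<close>
  define M2 where "M2 = (C + M\<^sup>2 + 1) / (2 * M)"
  have "M2 > 0"
    using M_pos \<open>C \<ge> 0\<close> by (simp add: M2_def add_nonneg_pos)
  have main: "(\<forall>t\<ge>0. invertible (block22 (R t z))) \<and>
      ((\<lambda>t. - (matrix_inv (block22 (R t z)) ** block21 (R t z))) \<longlongrightarrow> \<phi> z) at_top"
    if z: "Im z > M + 1" "Re z > M2" for z
  proof -
    have "C + M\<^sup>2 + 1 \<le> 2 * (Re z * M)"
      using z M_pos by (simp add: M2_def field_simps)
    moreover have "Re z * M \<le> Re z * Im z"
      using z \<open>M2 > 0\<close> by (intro mult_left_mono) auto
    ultimately have z_le: "Re z * M + (C + M\<^sup>2) / 2 - 2 * Re z * Im z \<le> - (1 / 2)"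
      by (simp add: field_simps)
    define K where "K = (norm z)\<^sup>2 + norm z * M + (C + M\<^sup>2) / 2"
    have "K \<ge> 0"
      using M_pos \<open>C \<ge> 0\<close> by (simp add: K_def)
    have R0: "R 0 z = mat 1"
      and R_deriv: "\<And>t. t \<ge> 0 \<Longrightarrow> ((\<lambda>t. R t z) has_vector_derivative Fmat v 0 t z ** R t z) (at t within {0..})"
      using R by (auto simp: normalized_fundamental_solution_def)
    have u0: "u 0 z = mat 1"
      and u_deriv: "\<And>x. x \<ge> 0 \<Longrightarrow> ((\<lambda>x. u x z) has_vector_derivative dirac_coeff v x z ** u x z) (at x within {0..})"
      using u by (auto simp: normalized_fundamental_solution_def)
    have dissipative: "y \<bullet> (jmat *v (Fmat v 0 t z *v y)) \<le> - (1 / 2) * (norm y)\<^sup>2" if "t \<ge> 0" for t y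
    proof -
      have "y \<bullet> (jmat *v (Fmat v 0 t z *v y)) \<le> (Re z * M + (C + M\<^sup>2) / 2 - 2 * Re z * Im z) * (norm y)\<^sup>2"
        using that v_bound C z \<open>M2 > 0\<close>
        by (subst Fmat_eq [OF v_x]) (auto intro!: Fmat_dissipative)
      also have "\<dots> \<le> - (1 / 2) * (norm y)\<^sup>2"
        by (intro mult_right_mono z_le) auto
      finally show ?thesis .
    qed
    have growth: "norm (Fmat v 0 t z *v y) \<le> K * norm y" if "t \<ge> 0" for t y
      using that v_bound C unfolding K_def
      by (subst Fmat_eq [OF v_x]) (auto intro!: Fmat_growth)
    have cone: "0 \<le> (R T z *v join c (\<phi> z *v c)) \<bullet> (jmat *v (R T z *v join c (\<phi> z *v c)))"
      if T: "T \<ge> 0" for T c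
    proof -
      \<comment> \<open>The assumed bounds hold on half-open time intervals; the end point
        \<open>T + 1\<close> makes the interval contain \<open>T\<close> itself and is positive also
        for \<open>T = 0\<close>.\<close>
      have "bdd_above ((\<lambda>(x, t). opnorm (partial_x v x t)) ` ({0..} \<times> {0..<T + 1}))"
        using vx_bound T by simp
      then obtain C' where C': "\<And>x t. x \<ge> 0 \<Longrightarrow> t \<in> {0..T} \<Longrightarrow> opnorm (partial_x v x t) \<le> C'"
        by (force simp: bdd_above_def)
      show ?thesis
      proof (rule weyl_solution_cone [OF C1 vxx nls, where w = "\<lambda>t. R t z *v join c (\<phi> z *v c)"
            and y\<^sub>0 = "\<lambda>x. u x z *v join c (\<phi> z *v c)" and M = M and C = C' and T = T and z = z])
        show "set_integrable lborel {0..} (\<lambda>x. (norm (u x z *v join c (\<phi> z *v c)))\<^sup>2)"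
          using z by (intro weyl_function_square_integrable [OF weyl]) simp
      qed (use v_bound C' T z in \<open>auto simp: R0 u0
            intro!: has_vector_derivative_matrix_solution R_deriv u_deriv\<close>)
    qed
    show ?thesis
      using dichotomy_limit [of "\<lambda>t. R t z" "\<lambda>t. Fmat v 0 t z" K "\<phi> z",
          OF R0 R_deriv dissipative growth \<open>K \<ge> 0\<close> cone]
      by blast
  qed
  show ?thesis
    using main \<open>M2 > 0\<close> by (intro exI [of _ "M + 1"] exI [of _ M2]) auto
qed

end
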